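(* For $\lambda\in\mathbb R$ let $f_\lambda:\mathbb T^2\to\mathbb T^2$, $\mathbb T^2=\mathbb R^2/\mathbb Z^2$, be the standard map $$f_\lambda(x,y)=\Big(x+y+\tfrac{\lambda}{2\pi}\sin(2\pi x),\; y+\tfrac{\lambda}{2\pi}\sin(2\pi x)\Big),$$ and let $p=(0,0)$, which for $\lambda>0$ is a fixed point of $f_\lambda$ of saddle type. If $\lambda\neq4$ and $\lambda>0$, then the four branches of $p$ have homoclinic points.
   Context: For a saddle fixed point $p$ of $f$, $W^s_p=\{x:\lim_{n\to+\infty}f^nx=p\}$ and $W^u_p=\{x:\lim_{n\to-\infty}f^nx=p\}$ are the stable and unstable manifolds of $p$. The four branches of $p$ are the components of $W^s_p-\{p\}$ and $W^u_p-\{p\}$ with respect to the topology induced by a parameterization of these immersed curves. A homoclinic point of $p$ is a point of $(W^s_p\cap W^u_p)-\{p\}$. A branch has homoclinic points if it contains such a point. *)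

theory Defs
  imports "HOL-Analysis.Analysis"
begin

definition torus_rel :: "real \<times> real \<Rightarrow> real \<times> real \<Rightarrow> bool" where
  "torus_rel v w \<longleftrightarrow> fst v - fst w \<in> \<int> \<and> snd v - snd w \<in> \<int>"

lemma equivp_torus_rel: "equivp torus_rel"
proof (rule equivpI)
  show "reflp torus_rel"
    by (simp add: reflp_def torus_rel_def)
  show "symp torus_rel"
  proof (rule sympI)
    fix v w assume "torus_rel v w"
    then have "- (fst v - fst w) \<in> \<int>" "- (snd v - snd w) \<in> \<int>"
      unfolding torus_rel_def by (blast intro: Ints_minus)+
    then show "torus_rel w v"
      by (simp add: torus_rel_def)
  qed
  show "transp torus_rel"
  proof (rule transpI)
    fix u v w assume "torus_rel u v" "torus_rel v w"
    then have "(fst u - fst v) + (fst v - fst w) \<in> \<int>" "(snd u - snd v) + (snd v - snd w) \<in> \<int>"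
      unfolding torus_rel_def by (blast intro: Ints_add)+
    then show "torus_rel u w"
      by (simp add: torus_rel_def)
  qed
qed

lemma torus_relE:
  assumes "torus_rel v w"
  obtains m n :: int where "fst v = fst w + of_int m" "snd v = snd w + of_int n"
proof -
  from assms obtain m n :: int where "fst v - fst w = of_int m" "snd v - snd w = of_int n"
    unfolding torus_rel_def by (blast elim: Ints_cases)
  then show ?thesis
    by (intro that[of m n]) linarith+
qed

lemma sin_shift: "sin (2 * pi * (x + of_int m)) = sin (2 * pi * x)"
proof -
  have "sin (2 * pi * x + 2 * pi * of_int m) = sin (2 * pi * x)"
    by (simp add: sin_add cos_int_2pin sin_int_2pin)
  then show ?thesis
    by (simp only: distrib_left)
qed

quotient_type torus = "real \<times> real" / torus_rel
  morphisms rep_torus torus_of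
  by (rule equivp_torus_rel)

instantiation torus :: topological_space
begin

definition open_torus :: "torus set \<Rightarrow> bool" where
  "open_torus U \<longleftrightarrow> open (torus_of -` U)"

instance
  by standard (auto simp: open_torus_def vimage_Union)

end

lift_definition standard_map :: "real \<Rightarrow> torus \<Rightarrow> torus" is
  "\<lambda>lam (x, y). (x + y + lam / (2 * pi) * sin (2 * pi * x), y + lam / (2 * pi) * sin (2 * pi * x))"
proof -
  fix lam :: real and v w :: "real \<times> real"
  assume "torus_rel v w"
  then obtain m n :: int where v: "fst v = fst w + of_int m" "snd v = snd w + of_int n"
    by (rule torus_relE)
  have "sin (2 * pi * fst v) = sin (2 * pi * fst w)"
    by (simp only: v sin_shift)
  then show "torus_rel
      (case v of (x, y) \<Rightarrow> (x + y + lam / (2 * pi) * sin (2 * pi * x), y + lam / (2 * pi) * sin (2 * pi * x)))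
      (case w of (x, y) \<Rightarrow> (x + y + lam / (2 * pi) * sin (2 * pi * x), y + lam / (2 * pi) * sin (2 * pi * x)))"
    using v by (auto simp: torus_rel_def case_prod_beta)
qed

lift_definition standard_map_inv :: "real \<Rightarrow> torus \<Rightarrow> torus" is
  "\<lambda>lam (x, y). (x - y, y - lam / (2 * pi) * sin (2 * pi * (x - y)))"
proof -
  fix lam :: real and v w :: "real \<times> real"
  assume "torus_rel v w"
  then obtain m n :: int where v: "fst v = fst w + of_int m" "snd v = snd w + of_int n"
    by (rule torus_relE)
  have "fst v - snd v = fst w - snd w + of_int (m - n)"
    by (simp add: v)
  then have "sin (2 * pi * (fst v - snd v)) = sin (2 * pi * (fst w - snd w))"
    by (simp only: sin_shift)
  then show "torus_rel
      (case v of (x, y) \<Rightarrow> (x - y, y - lam / (2 * pi) * sin (2 * pi * (x - y))))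
      (case w of (x, y) \<Rightarrow> (x - y, y - lam / (2 * pi) * sin (2 * pi * (x - y))))"
    using v by (auto simp: torus_rel_def case_prod_beta)
qed

lemma bij_standard_map: "bij (standard_map lam)"
proof (rule o_bij[where g = "standard_map_inv lam"])
  show "standard_map_inv lam \<circ> standard_map lam = id"
    by (rule ext, simp, transfer) (auto simp: torus_rel_def)
  show "standard_map lam \<circ> standard_map_inv lam = id"
    by (rule ext, simp, transfer) (auto simp: torus_rel_def)
qed

text \<open>
  The derivative of \<open>f\<close> at \<open>p\<close> is taken in the plane: \<open>F\<close> is a lift of \<open>f\<close>
  that is differentiable over \<open>p\<close>.  Two such lifts differ near \<open>v\<close> by a constant
  integer vector, so \<open>A\<close> does not depend on the choice of \<open>F\<close> or \<open>v\<close>.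
  In dimension two, the eigenvalues of a saddle are automatically real.
\<close>

definition saddle_fixed_point :: "(torus \<Rightarrow> torus) \<Rightarrow> torus \<Rightarrow> bool" where
  "saddle_fixed_point f p \<longleftrightarrow> f p = p \<and>
    (\<exists>F v A. torus_of v = p \<and> (\<forall>w. f (torus_of w) = torus_of (F w)) \<and>
      (F has_derivative A) (at v) \<and>
      (\<exists>\<mu> \<nu> a b. a \<noteq> 0 \<and> b \<noteq> 0 \<and> A a = \<mu> *\<^sub>R a \<and> A b = \<nu> *\<^sub>R b \<and> \<bar>\<mu>\<bar> < 1 \<and> 1 < \<bar>\<nu>\<bar>))"

definition stable_manifold :: "(torus \<Rightarrow> torus) \<Rightarrow> torus \<Rightarrow> torus set" where
  "stable_manifold f p = {x. (\<lambda>n. (f ^^ n) x) \<longlonglongrightarrow> p}"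

definition unstable_manifold :: "(torus \<Rightarrow> torus) \<Rightarrow> torus \<Rightarrow> torus set" where
  "unstable_manifold f p = {x. (\<lambda>n. (inv f ^^ n) x) \<longlonglongrightarrow> p}"

definition homoclinic_points :: "(torus \<Rightarrow> torus) \<Rightarrow> torus \<Rightarrow> torus set" where
  "homoclinic_points f p = (stable_manifold f p \<inter> unstable_manifold f p) - {p}"

text \<open>
  An injective \<open>C\<^sup>1\<close> immersion of the real line with image \<open>W\<close>.  Since the line is
  simply connected, regularity can be expressed through a lift \<open>c\<close> to the plane.
\<close>

definition curve_parameterization :: "(real \<Rightarrow> torus) \<Rightarrow> torus set \<Rightarrow> bool" where
  "curve_parameterization \<gamma> W \<longleftrightarrow> inj \<gamma> \<and> range \<gamma> = W \<and>
    (\<exists>c c'. (\<forall>t. \<gamma> t = torus_of (c t)) \<and>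
      (\<forall>t. (c has_vector_derivative c' t) (at t)) \<and>
      continuous_on UNIV c' \<and> (\<forall>t. c' t \<noteq> 0))"

text \<open>
  The topology that an injective \<open>\<gamma>\<close> transports from the line to its image: the
  open sets are the images under \<open>\<gamma>\<close> of the open sets of reals.
\<close>

definition curve_topology :: "(real \<Rightarrow> torus) \<Rightarrow> torus topology" where
  "curve_topology \<gamma> = pullback_topology (range \<gamma>) (inv \<gamma>) euclideanreal"

lemma openin_curve_topology:
  assumes "inj \<gamma>"
  shows "openin (curve_topology \<gamma>) U \<longleftrightarrow> (\<exists>V. open V \<and> U = \<gamma> ` V)"
proof -
  have "inv \<gamma> -` V \<inter> range \<gamma> = \<gamma> ` V" for V
    using assms by (auto simp: inv_f_f)
  then show ?thesis
    by (simp add: curve_topology_def openin_pullback_topology)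
qed

text \<open>
  The components of \<open>W - {p}\<close> are collected over all parameterizations of \<open>W\<close>.
  If \<open>W\<close> has none, the set is empty; if the components depend on the
  parameterization, it contains those of each.
\<close>

definition curve_branches :: "torus set \<Rightarrow> torus \<Rightarrow> torus set set" where
  "curve_branches W p = {B. \<exists>\<gamma>. curve_parameterization \<gamma> W \<and>
     B \<in> connected_components_of (subtopology (curve_topology \<gamma>) (W - {p}))}"

definition stable_branches :: "(torus \<Rightarrow> torus) \<Rightarrow> torus \<Rightarrow> torus set set" where
  "stable_branches f p = curve_branches (stable_manifold f p) p"

definition unstable_branches :: "(torus \<Rightarrow> torus) \<Rightarrow> torus \<Rightarrow> torus set set" where
  "unstable_branches f p = curve_branches (unstable_manifold f p) p"

definition has_homoclinic_points :: "(torus \<Rightarrow> torus) \<Rightarrow> torus \<Rightarrow> torus set \<Rightarrow> bool" where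
  "has_homoclinic_points f p B \<longleftrightarrow> B \<inter> homoclinic_points f p \<noteq> {}"

end

theory Submission
  imports Defs "HOL-Complex_Analysis.Complex_Analysis"
begin

text \<open>
  Along an orbit of the lifted map the first coordinates satisfy the recurrence
  \<open>x_{n+1} - 2 x_n + x_{n-1} = kick x_n\<close>, where \<open>kick t\<close> is \<open>lam / (2 pi) * sin (2 pi t)\<close>,
  and the second coordinate of a point is \<open>x_n - x_{n-1}\<close>.  The recurrence is symmetric in
  time, and \<open>kick\<close> is odd, 1-periodic and nonnegative on \<open>{0..1/2}\<close>.  Everything rests on this.

  Homoclinic points.  The unstable curve of \<open>p\<close> is parameterized by an odd solution \<open>x\<close> of
  \<open>x (\<nu> * s) - 2 * x s + x (s / \<nu>) = kick (x s)\<close>, where \<open>\<nu>\<close> is the unstable eigenvalue.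
  While an orbit moves up from \<open>0\<close> with positions at most \<open>1/2\<close>, its increments do not
  decrease, so the curve reaches the position \<open>1/2\<close> (\<open>x_reaches_half\<close>).  The orbit
  through that point is symmetric under \<open>t \<mapsto> 1 - t\<close> and reversal of time, hence it also
  converges to \<open>p\<close> forwards (\<open>symmetric_homoclinic_point\<close>).  This puts a homoclinic point
  on one unstable and one stable branch, and the symmetry \<open>v \<mapsto> - v\<close> serves the
  other two.

  Invariant curves.  The solution \<open>x\<close> is the restriction to the real line of an entire
  function, found as a limit of graph transforms (\<open>entire_unstable_solution\<close>).  That the curve is
  the whole unstable manifold follows from a discrete maximum principle
  (\<open>bounded_solution_unique\<close>): near \<open>p\<close> a bounded backward orbit is determined by its position.
  The stable manifold is the image of the unstable one under a linear involution.

  Two branches.  The set of branches is formed over all regular parameterizations of the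
  manifold, an immersed curve that may accumulate on itself.  A Baire category argument
  (\<open>continuous_change_of_parameter\<close>) shows that any two of them differ by a homeomorphism away
  from \<open>p\<close>, so that the branches are exactly the two halves of the curve above
  (\<open>curve_branches_eq\<close>).
\<close>

section \<open>The topology of the torus\<close>

lemma open_torus_iff: "open U \<longleftrightarrow> open (torus_of -` U)"
  by (simp add: open_torus_def)

lemma continuous_on_torus_iff:
  fixes g :: "torus \<Rightarrow> 'a::topological_space"
  shows "continuous_on UNIV g \<longleftrightarrow> continuous_on UNIV (g \<circ> torus_of)"
  by (simp add: continuous_on_open_vimage open_torus_iff vimage_comp comp_def)

lemma continuous_torus_of: "continuous_on S torus_of"
proof -
  have "continuous_on UNIV torus_of"
    by (simp add: continuous_on_open_vimage open_torus_iff)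
  then show ?thesis using continuous_on_subset by blast
qed

lemma torus_of_eq_iff: "torus_of v = torus_of w \<longleftrightarrow> torus_rel v w"
  by (simp add: torus.abs_eq_iff)

text \<open>
  The torus carries the quotient topology.  It is Hausdorff because the exponentials of the
  two angles are continuous and separate its points.
\<close>

lift_definition torus_embedding :: "torus \<Rightarrow> complex \<times> complex" is
  "\<lambda>(x, y). (cis (2 * pi * x), cis (2 * pi * y))"
proof -
  fix v w :: "real \<times> real"
  assume "torus_rel v w"
  then obtain m n :: int where v: "fst v = fst w + of_int m" "snd v = snd w + of_int n"
    by (rule torus_relE)
  have *: "cis (2 * pi * (x + of_int k)) = cis (2 * pi * x)" for x k
  proof -
    have "cis (2 * pi * (x + of_int k)) = cis (2 * pi * x) * cis (2 * pi * of_int k)"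
      by (simp only: cis_mult distrib_left)
    then show ?thesis by (simp add: cis_multiple_2pi)
  qed
  then show "(case v of (x, y) \<Rightarrow> (cis (2 * pi * x), cis (2 * pi * y))) =
             (case w of (x, y) \<Rightarrow> (cis (2 * pi * x), cis (2 * pi * y)))"
    using v by (simp add: case_prod_beta)
qed

lemma cis_eq_imp_Ints:
  assumes "cis (2 * pi * x) = cis (2 * pi * y)"
  shows "x - y \<in> \<int>"
proof -
  have "cis (2 * pi * (x - y)) = cis (2 * pi * x) / cis (2 * pi * y)"
    by (simp add: cis_divide right_diff_distrib)
  also have "\<dots> = 1" using assms by simp
  finally have "cos (2 * pi * (x - y)) = 1"
    by (metis cis.sel(1) one_complex.sel(1))
  then obtain n :: int where "2 * pi * (x - y) = of_int n * 2 * pi"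
    using cos_one_2pi_int by blast
  then show ?thesis by simp
qed

lemma inj_torus_embedding: "inj torus_embedding"
proof (rule injI)
  show "u = v" if "torus_embedding u = torus_embedding v" for u v
    using that by transfer (auto simp: torus_rel_def intro: cis_eq_imp_Ints)
qed

lemma continuous_torus_embedding: "continuous_on UNIV torus_embedding"
proof -
  have "torus_embedding \<circ> torus_of = (\<lambda>v. (cis (2 * pi * fst v), cis (2 * pi * snd v)))"
    by (rule ext) (simp add: torus_embedding.abs_eq case_prod_beta)
  then show ?thesis
    unfolding continuous_on_torus_iff by (simp only:) (intro continuous_intros)
qed

instance torus :: t2_space
proof
  fix u v :: torus
  assume "u \<noteq> v"
  then have "torus_embedding u \<noteq> torus_embedding v"
    using inj_torus_embedding by (simp add: inj_eq)
  then obtain U V where "open U" "open V" "torus_embedding u \<in> U" "torus_embedding v \<in> V" "U \<inter> V = {}"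
    using hausdorff[of "torus_embedding u" "torus_embedding v"] by blast
  moreover have "open (torus_embedding -` U)" "open (torus_embedding -` V)"
    using calculation continuous_torus_embedding by (auto simp: continuous_on_open_vimage)
  ultimately show "\<exists>U V. open U \<and> open V \<and> u \<in> U \<and> v \<in> V \<and> U \<inter> V = {}"
    by (intro exI[of _ "torus_embedding -` U"] exI[of _ "torus_embedding -` V"]) auto
qed

text \<open>
  The covering map is open: the full preimage of the image of an open set is the union of its
  integer translates.  This is what lifts an orbit that converges to \<open>torus_of v\<close>
  to representatives near \<open>v\<close>, although the limit is only known downstairs.
\<close>

lemma open_torus_of_image:
  assumes "open B"
  shows "open (torus_of ` B)"
proof -
  have "torus_of -` torus_of ` B = (\<Union>m::int. \<Union>n::int. (+) (of_int m, of_int n) ` B)"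
  proof (intro set_eqI iffI)
    fix w assume "w \<in> torus_of -` torus_of ` B"
    then obtain b where "b \<in> B" "torus_rel w b" by (auto simp: torus_of_eq_iff)
    then obtain m n :: int where "fst w = fst b + of_int m" "snd w = snd b + of_int n"
      by (blast elim: torus_relE)
    then have "w = (of_int m, of_int n) + b" by (simp add: prod_eq_iff)
    with \<open>b \<in> B\<close> show "w \<in> (\<Union>m::int. \<Union>n::int. (+) (of_int m, of_int n) ` B)" by blast
  next
    fix w assume "w \<in> (\<Union>m::int. \<Union>n::int. (+) (of_int m, of_int n) ` B)"
    then obtain m n :: int and b where "b \<in> B" "w = (of_int m, of_int n) + b" by blast
    then have "torus_rel w b" by (simp add: torus_rel_def)
    with \<open>b \<in> B\<close> show "w \<in> torus_of -` torus_of ` B" by (auto simp: torus_of_eq_iff)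
  qed
  then show ?thesis
    using assms by (auto simp: open_torus_iff intro!: open_UN open_translation)
qed

lemma tendsto_torus_representatives:
  assumes "X \<longlonglongrightarrow> torus_of v" "open B" "v \<in> B"
  shows "\<forall>\<^sub>F n in sequentially. X n \<in> torus_of ` B"
  using topological_tendstoD[OF assms(1) open_torus_of_image[OF assms(2)]] assms(3) by blast

section \<open>Changes of parameter of an injective curve\<close>

text \<open>
  A bounded change of parameter \<open>h\<close> takes its values in a compact interval, on which an
  injective curve in a Hausdorff space is a homeomorphism onto its image.
\<close>

lemma continuous_on_bounded_parameter:
  fixes \<gamma> :: "real \<Rightarrow> 'a::t2_space" and \<delta> :: "real \<Rightarrow> 'a"
  assumes c1: "continuous_on UNIV \<gamma>" and inj: "inj \<gamma>"
    and c2: "continuous_on S \<delta>" and h: "\<And>t. t \<in> S \<Longrightarrow> \<gamma> (h t) = \<delta> t"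
    and n: "\<And>t. t \<in> S \<Longrightarrow> \<bar>h t\<bar> \<le> n"
  shows "continuous_on S h"
proof -
  have "continuous_on (\<gamma> ` {-n..n}) (inv \<gamma>)"
    by (rule continuous_on_inv) (use c1 inj in \<open>auto intro: continuous_on_subset\<close>)
  moreover have "\<delta> ` S \<subseteq> \<gamma> ` {-n..n}"
  proof safe
    fix t assume "t \<in> S"
    then have "h t \<in> {-n..n}" using n[of t] by auto
    then show "\<delta> t \<in> \<gamma> ` {-n..n}" using h[OF \<open>t \<in> S\<close>] by (metis imageI)
  qed
  ultimately have "continuous_on S (\<lambda>t. inv \<gamma> (\<delta> t))"
    using c2 continuous_on_compose2 by blast
  then show ?thesis
    by (rule continuous_on_eq) (metis h inj inv_f_f)
qed

text \<open>
  The change of parameter can only fail to extend to the end \<open>a\<close> of a gap by escaping to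
  infinity.  Then, on every short piece of \<open>\<delta>\<close> to the right of \<open>a\<close>, the parameter
  \<open>h\<close> passes both through a value and, still closer to \<open>a\<close>, through \<open>\<nu>\<close> times
  that value.  The map \<open>\<phi>\<close>, which multiplies parameters by \<open>\<nu>\<close>, therefore moves points
  of \<open>\<delta>\<close> that tend to \<open>\<delta> a\<close> to points with the same limit, and \<open>\<delta> a\<close> is fixed.
\<close>

lemma continuous_change_at_left_end:
  fixes \<gamma> :: "real \<Rightarrow> 'a::t2_space" and \<delta> :: "real \<Rightarrow> 'a"
  assumes c1: "continuous_on UNIV \<gamma>" and inj: "inj \<gamma>"
    and c2: "continuous_on {a..b} \<delta>" and h: "\<And>t. t \<in> {a..b} \<Longrightarrow> \<gamma> (h t) = \<delta> t"
    and h0: "\<And>t. t \<in> {a..b} \<Longrightarrow> h t \<noteq> 0"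
    and ch: "continuous_on {a<..b} h" and ab: "a < b"
    and \<phi>: "continuous_on UNIV \<phi>" "\<And>s. \<phi> (\<gamma> s) = \<gamma> (\<nu> * s)" "\<nu> > 1" "\<phi> (\<delta> a) \<noteq> \<delta> a"
  shows "continuous_on {a..b} h"
proof -
  have "\<exists>n. \<forall>t\<in>{a<..b}. \<bar>h t\<bar> \<le> n"
  proof (rule ccontr)
    assume unb: "\<not> ?thesis"
    \<comment> \<open>Since \<open>h\<close> is unbounded near \<open>a\<close> but bounded on \<open>{t..b}\<close>, it exceeds
      \<open>\<nu> * h t\<close> in size somewhere in \<open>{a<..<t}\<close>; as \<open>h\<close> has no zeros, the sign is
      the same there, and the intermediate value theorem applies.\<close>
    have next_pt: "\<exists>t'. a < t' \<and> t' < t \<and> h t' = \<nu> * h t" if t: "a < t" "t \<le> b" for t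
    proof -
      have "continuous_on {t..b} h" using ch t by (auto intro: continuous_on_subset)
      then have "bounded (h ` {t..b})" by (intro compact_imp_bounded compact_continuous_image) auto
      then obtain B where B: "\<And>u. u \<in> {t..b} \<Longrightarrow> \<bar>h u\<bar> \<le> B" unfolding bounded_iff by fastforce
      obtain u where u: "u \<in> {a<..b}" "\<bar>h u\<bar> > max B (\<nu> * \<bar>h t\<bar>)"
        using unb by (metis not_le)
      have ut: "u < t"
      proof (rule ccontr)
        assume "\<not> u < t"
        then show False using u B[of u] by auto
      qed
      have cut: "continuous_on {u..t} h" using ch u t by (auto intro: continuous_on_subset)
      have nz: "h w \<noteq> 0" if "w \<in> {u..t}" for w using that u t by (intro h0) auto
      have \<nu>t: "\<bar>\<nu> * h t\<bar> > \<bar>h t\<bar>" using \<phi>(3) nz[of t] ut by (simp add: abs_mult)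
      have "\<exists>w\<ge>u. w \<le> t \<and> h w = \<nu> * h t"
      proof (cases "h t > 0")
        case True
        have "h u > 0"
        proof (rule ccontr)
          assume "\<not> h u > 0"
          then have "\<exists>w\<ge>u. w \<le> t \<and> h w = 0" using True ut by (intro IVT' cut) auto
          then show False using nz by auto
        qed
        then show ?thesis using u(2) True \<nu>t ut \<phi>(3) by (intro IVT2' cut) (auto simp: abs_mult)
      next
        case False
        then have neg: "h t < 0" using nz[of t] ut by auto
        have "h u < 0"
        proof (rule ccontr)
          assume "\<not> h u < 0"
          then have "\<exists>w\<ge>u. w \<le> t \<and> h w = 0" using neg ut by (intro IVT2' cut) auto
          then show False using nz by auto
        qed
        then show ?thesis using u(2) neg \<nu>t ut \<phi>(3) by (intro IVT' cut) (auto simp: abs_mult)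
      qed
      then obtain w where w: "u \<le> w" "w \<le> t" "h w = \<nu> * h t" by blast
      then have "w \<noteq> t" using \<nu>t by auto
      then show ?thesis using w u by (intro exI[of _ w]) auto
    qed
    define \<tau> where "\<tau> n = a + (b - a) / real (Suc n)" for n
    have \<tau>: "a < \<tau> n" "\<tau> n \<le> b" for n
    proof -
      show "a < \<tau> n" using ab by (simp add: \<tau>_def)
      have "(b - a) / real (Suc n) \<le> (b - a) / 1" using ab by (intro divide_left_mono) auto
      then show "\<tau> n \<le> b" by (simp add: \<tau>_def)
    qed
    have "\<tau> \<longlonglongrightarrow> a + 0"
      unfolding \<tau>_def
      by (intro tendsto_add tendsto_const LIMSEQ_Suc[OF lim_const_over_n])
    then have \<tau>_lim: "\<tau> \<longlonglongrightarrow> a" by simp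
    obtain \<sigma> where \<sigma>: "\<And>n. a < \<sigma> n" "\<And>n. \<sigma> n < \<tau> n" "\<And>n. h (\<sigma> n) = \<nu> * h (\<tau> n)"
      using choice[of "\<lambda>n t. a < t \<and> t < \<tau> n \<and> h t = \<nu> * h (\<tau> n)"] next_pt[OF \<tau>] by blast
    have \<sigma>_lim: "\<sigma> \<longlonglongrightarrow> a"
      by (rule tendsto_sandwich[OF _ _ tendsto_const \<tau>_lim]) (simp_all add: \<sigma> less_imp_le)
    have lim2: "(\<lambda>n. \<delta> (s n)) \<longlonglongrightarrow> \<delta> a" if "s \<longlonglongrightarrow> a" "\<And>n. s n \<in> {a..b}" for s
      using c2 that ab by (intro continuous_on_tendsto_compose[OF c2]) auto
    have "\<delta> (\<sigma> n) = \<phi> (\<delta> (\<tau> n))" for n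
    proof -
      have "\<sigma> n \<in> {a..b}" "\<tau> n \<in> {a..b}" using \<tau>[of n] \<sigma>(1)[of n] \<sigma>(2)[of n] by auto
      then show ?thesis using h[of "\<sigma> n"] h[of "\<tau> n"] \<sigma>(3)[of n] \<phi>(2)[of "h (\<tau> n)"] by simp
    qed
    moreover have "(\<lambda>n. \<delta> (\<sigma> n)) \<longlonglongrightarrow> \<delta> a"
      by (rule lim2[OF \<sigma>_lim]) (simp add: \<sigma> less_imp_le order.trans[OF less_imp_le[OF \<sigma>(2)] \<tau>(2)])
    moreover have "(\<lambda>n. \<phi> (\<delta> (\<tau> n))) \<longlonglongrightarrow> \<phi> (\<delta> a)"
      by (rule continuous_on_tendsto_compose[OF \<phi>(1) lim2[OF \<tau>_lim]])
         (simp_all add: \<tau> less_imp_le)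
    ultimately have "\<delta> a = \<phi> (\<delta> a)" by (simp add: LIMSEQ_unique)
    then show False using \<phi>(4) by simp
  qed
  then obtain n where n: "\<And>t. t \<in> {a<..b} \<Longrightarrow> \<bar>h t\<bar> \<le> n" by blast
  have closed: "closed (\<gamma> ` {-n..n})"
    by (intro compact_imp_closed compact_continuous_image continuous_on_subset[OF c1]) auto
  have "\<delta> ` {a<..b} \<subseteq> \<gamma> ` {-n..n}"
  proof safe
    fix t assume t: "t \<in> {a<..b}"
    then have "h t \<in> {-n..n}" "\<gamma> (h t) = \<delta> t" using n[of t] h[of t] by auto
    then show "\<delta> t \<in> \<gamma> ` {-n..n}" by (metis imageI)
  qed
  moreover have "closure {a<..b} = {a..b}" using ab by simp
  ultimately have "\<delta> ` {a..b} \<subseteq> \<gamma> ` {-n..n}"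
    using image_closure_subset[of "{a<..b}" \<delta>] c2 closed by simp
  then obtain s where "s \<in> {-n..n}" "\<delta> a = \<gamma> s" using ab by force
  moreover have "\<gamma> (h a) = \<delta> a" using h ab by auto
  ultimately have "h a = s" using inj by (metis injD)
  then have ha: "\<bar>h a\<bar> \<le> n" using \<open>s \<in> _\<close> by auto
  have "\<bar>h t\<bar> \<le> n" if "t \<in> {a..b}" for t
    using n[of t] ha that by (cases "t = a") auto
  then show ?thesis using continuous_on_bounded_parameter[OF c1 inj c2 h] by blast
qed

lemma continuous_change_at_right_end:
  fixes \<gamma> :: "real \<Rightarrow> 'a::t2_space" and \<delta> :: "real \<Rightarrow> 'a"
  assumes c1: "continuous_on UNIV \<gamma>" and inj: "inj \<gamma>"
    and c2: "continuous_on {a..b} \<delta>" and h: "\<And>t. t \<in> {a..b} \<Longrightarrow> \<gamma> (h t) = \<delta> t"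
    and h0: "\<And>t. t \<in> {a..b} \<Longrightarrow> h t \<noteq> 0"
    and ch: "continuous_on {a..<b} h" and ab: "a < b"
    and \<phi>: "continuous_on UNIV \<phi>" "\<And>s. \<phi> (\<gamma> s) = \<gamma> (\<nu> * s)" "\<nu> > 1" "\<phi> (\<delta> b) \<noteq> \<delta> b"
  shows "continuous_on {a..b} h"
proof -
  have "continuous_on {-b..-a} (\<lambda>t. h (- t))"
  proof (rule continuous_change_at_left_end[OF c1 inj, where \<delta> = "\<lambda>t. \<delta> (- t)" and \<phi> = \<phi> and \<nu> = \<nu>])
    show "continuous_on {-b..-a} (\<lambda>t. \<delta> (- t))"
      by (rule continuous_on_compose2[OF c2]) (auto intro!: continuous_intros)
    show "continuous_on {-b<..-a} (\<lambda>t. h (- t))"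
      by (rule continuous_on_compose2[OF ch]) (auto intro!: continuous_intros)
  qed (use h h0 ab \<phi> in auto)
  then have "continuous_on {a..b} (\<lambda>t. h (- (- t)))"
    by (rule continuous_on_compose2) (auto intro!: continuous_intros)
  then show ?thesis by simp
qed

text \<open>
  Two injective curves with values in the same set may induce different topologies on it, so
  the continuity of \<open>h\<close> is not formal.  Let \<open>D\<close> be the closed set of parameters near which
  \<open>h\<close> is unbounded; off \<open>D\<close> the map \<open>h\<close> is continuous.  The sets on which
  \<open>\<bar>h\<bar> \<le> n\<close> are closed, so by Baire's theorem one of them contains a nonempty relatively
  open part of \<open>D\<close>.  Over each gap of \<open>D\<close> the map \<open>h\<close> is continuous up to the ends of the
  gap by the preceding lemmas, hence monotone, so it is bounded by its values at the ends.  Thus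
  \<open>h\<close> is bounded near that part of \<open>D\<close>, contrary to the choice of \<open>D\<close>.
\<close>

lemma continuous_change_of_parameter:
  fixes \<gamma> :: "real \<Rightarrow> 'a::t2_space" and \<delta> :: "real \<Rightarrow> 'a"
  assumes c1: "continuous_on UNIV \<gamma>" and inj: "inj \<gamma>"
    and J: "open J" "convex J" and c2: "continuous_on J \<delta>" and injd: "inj_on \<delta> J"
    and h: "\<And>t. t \<in> J \<Longrightarrow> \<gamma> (h t) = \<delta> t"
    and h0: "\<And>t. t \<in> J \<Longrightarrow> h t \<noteq> 0"
    and \<phi>: "continuous_on UNIV \<phi>" "\<And>s. \<phi> (\<gamma> s) = \<gamma> (\<nu> * s)" "\<nu> > 1"
      "\<And>t. t \<in> J \<Longrightarrow> \<phi> (\<delta> t) \<noteq> \<delta> t"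
  shows "continuous_on J h"
proof -
  define D where "D = {t \<in> J. \<forall>\<epsilon>>0. \<forall>n. \<exists>u. \<bar>u - t\<bar> < \<epsilon> \<and> u \<in> J \<and> \<bar>h u\<bar> > n}"
  have tame: "isCont h t" if t: "t \<in> J" "t \<notin> D" for t
  proof -
    obtain \<epsilon> n where \<epsilon>: "\<epsilon> > 0" "\<And>u. \<bar>u - t\<bar> < \<epsilon> \<Longrightarrow> u \<in> J \<Longrightarrow> \<bar>h u\<bar> \<le> n"
      using t unfolding D_def mem_Collect_eq by (meson not_less)
    have "continuous_on (ball t \<epsilon> \<inter> J) h"
      by (rule continuous_on_bounded_parameter[OF c1 inj continuous_on_subset[OF c2], where n = n])
         (use \<epsilon> h in \<open>auto simp: dist_real_def abs_minus_commute\<close>)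
    then show ?thesis
      using \<epsilon>(1) t(1) J(1) by (simp add: continuous_on_eq_continuous_at open_Int)
  qed
  have interval: "{a..b} \<subseteq> J" if "a \<in> J" "b \<in> J" for a b
    using J(2) that by (metis convex_contains_segment closed_segment_eq_real_ivl empty_subsetI
        atLeastatMost_empty not_le)
  have inj_h: "inj_on h S" if "S \<subseteq> J" for S
    by (rule inj_onI) (use h injd that in \<open>metis inj_onD subsetD\<close>)
  have gap: "\<bar>h t\<bar> \<le> max \<bar>h a\<bar> \<bar>h b\<bar>"
    if ab: "a \<in> J" "b \<in> J" "a \<le> t" "t \<le> b" and free: "\<And>u. a < u \<Longrightarrow> u < b \<Longrightarrow> u \<notin> D" for a b t
  proof (cases "a < t \<and> t < b")
    case True
    have sub: "{a..b} \<subseteq> J" by (rule interval[OF ab(1,2)])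
    then have in_J: "\<And>u. a \<le> u \<Longrightarrow> u \<le> b \<Longrightarrow> u \<in> J" by auto
    have open_gap: "continuous_on {a<..<b} h"
      by (rule continuous_at_imp_continuous_on) (use tame free in_J in auto)
    have "continuous_on {a..t} h"
    proof (rule continuous_change_at_left_end[OF c1 inj, where \<delta> = \<delta> and \<phi> = \<phi> and \<nu> = \<nu>])
      show "continuous_on {a<..t} h" using open_gap by (rule continuous_on_subset) (use True in auto)
      show "continuous_on {a..t} \<delta>" using c2 by (rule continuous_on_subset) (use True in_J in auto)
    qed (use True in_J h h0 \<phi> in auto)
    moreover have "continuous_on {t..b} h"
    proof (rule continuous_change_at_right_end[OF c1 inj, where \<delta> = \<delta> and \<phi> = \<phi> and \<nu> = \<nu>])
      show "continuous_on {t..<b} h" using open_gap by (rule continuous_on_subset) (use True in auto)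
      show "continuous_on {t..b} \<delta>" using c2 by (rule continuous_on_subset) (use True in_J in auto)
    qed (use True in_J h h0 \<phi> in auto)
    ultimately have "continuous_on ({a..t} \<union> {t..b}) h"
      by (intro continuous_on_closed_Un) auto
    moreover have "{a..t} \<union> {t..b} = {a..b}" using True by auto
    ultimately have "continuous_on {a..b} h" by simp
    then have "(h a < h t \<and> h t < h b) \<or> (h b < h t \<and> h t < h a)"
      using True by (intro continuous_inj_imp_mono inj_h sub) auto
    then show ?thesis by auto
  next
    case False
    then have "t = a \<or> t = b" using ab by auto
    then show ?thesis by auto
  qed
  have closed_D: "closed (D \<inter> {a..b})" if "{a..b} \<subseteq> J" for a b
  proof -
    have "open (J - D)"
      unfolding open_dist
    proof
      fix t assume t: "t \<in> J - D"
      then obtain \<epsilon> n where \<epsilon>: "\<epsilon> > 0" "\<And>u. \<bar>u - t\<bar> < \<epsilon> \<Longrightarrow> u \<in> J \<Longrightarrow> \<bar>h u\<bar> \<le> n"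
        unfolding D_def Diff_iff mem_Collect_eq by (meson not_less)
      obtain \<eta> where \<eta>: "\<eta> > 0" "\<And>u. \<bar>u - t\<bar> < \<eta> \<Longrightarrow> u \<in> J"
        using J(1) t by (auto simp: open_dist dist_real_def)
      have "u \<in> J - D" if u: "\<bar>u - t\<bar> < min \<epsilon> \<eta>" for u
      proof -
        have "u \<notin> D"
        proof
          assume "u \<in> D"
          moreover have "\<epsilon> - \<bar>u - t\<bar> > 0" using u by auto
          ultimately obtain v where v: "\<bar>v - u\<bar> < \<epsilon> - \<bar>u - t\<bar>" "v \<in> J" "\<bar>h v\<bar> > n"
            unfolding D_def by blast
          then have "\<bar>v - t\<bar> < \<epsilon>" by auto
          then show False using \<epsilon>(2)[of v] v by auto
        qed
        then show ?thesis using \<eta>(2) u by auto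
      qed
      then show "\<exists>e>0. \<forall>y. dist y t < e \<longrightarrow> y \<in> J - D"
        using \<epsilon>(1) \<eta>(1) by (intro exI[of _ "min \<epsilon> \<eta>"]) (auto simp: dist_real_def)
    qed
    moreover have "D \<inter> {a..b} = {a..b} - (J - D)" using that by (auto simp: D_def)
    ultimately show ?thesis by (simp add: closed_Diff)
  qed
  have "D = {}"
  proof (rule ccontr)
    assume "D \<noteq> {}"
    then obtain d where d: "d \<in> D" by blast
    then have "d \<in> J" by (simp add: D_def)
    then obtain e where e: "e > 0" "cball d e \<subseteq> J" using J(1) open_contains_cball by blast
    define l r where "l = d - e" and "r = d + e"
    have lr: "{l..r} \<subseteq> J" "l < d" "d < r"
      using e by (auto simp: l_def r_def cball_eq_atLeastAtMost)
    \<comment> \<open>The closure of a part of \<open>D\<close> that is open in \<open>D\<close>: every relatively open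
      subset of \<open>S\<close> meets \<open>D\<close> strictly between \<open>l\<close> and \<open>r\<close>.\<close>
    define S where "S = closure (D \<inter> {l<..<r})"
    have S_sub: "S \<subseteq> D \<inter> {l..r}"
      unfolding S_def by (intro closure_minimal closed_D lr) auto
    define T where "T n = {t \<in> S. \<bar>h t\<bar> \<le> real n}" for n :: nat
    have T_closed: "closed (T n)" for n
    proof -
      have "closed (\<gamma> ` {-real n..real n})"
        by (intro compact_imp_closed compact_continuous_image continuous_on_subset[OF c1]) auto
      moreover have "continuous_on S \<delta>"
        by (rule continuous_on_subset[OF c2]) (use S_sub lr in auto)
      ultimately have "closed (S \<inter> \<delta> -` (\<gamma> ` {-real n..real n}))"
        by (intro continuous_closed_preimage) (auto simp: S_def)
      moreover have "S \<inter> \<delta> -` (\<gamma> ` {-real n..real n}) = T n"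
      proof -
        have "\<delta> t \<in> \<gamma> ` {-real n..real n} \<longleftrightarrow> \<bar>h t\<bar> \<le> real n" if "t \<in> S" for t
        proof -
          have "t \<in> J" using that S_sub lr by auto
          then have "\<delta> t \<in> \<gamma> ` {-real n..real n} \<longleftrightarrow> h t \<in> {-real n..real n}"
            using h[of t] inj by (metis inj_image_mem_iff)
          then show ?thesis by auto
        qed
        then show ?thesis by (auto simp: T_def)
      qed
      ultimately show ?thesis by simp
    qed
    have "\<exists>n. \<exists>t\<in>S. \<exists>\<epsilon>>0. \<forall>u\<in>S. \<bar>u - t\<bar> < \<epsilon> \<longrightarrow> \<bar>h u\<bar> \<le> real n"
    proof (rule ccontr)
      assume no: "\<not> ?thesis"
      have dense: "S \<subseteq> closure (\<Inter>(range (\<lambda>n. S - T n)))"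
      proof (rule Baire)
        fix G assume "G \<in> range (\<lambda>n. S - T n)"
        then obtain n where G: "G = S - T n" by (rule rangeE)
        have "S \<subseteq> closure G"
        proof
          fix t assume t: "t \<in> S"
          have "\<exists>u\<in>G. dist u t < \<epsilon>" if \<epsilon>: "\<epsilon> > 0" for \<epsilon>
          proof -
            obtain u where "u \<in> S" "\<bar>u - t\<bar> < \<epsilon>" "\<not> \<bar>h u\<bar> \<le> real n"
              using no t \<epsilon> by blast
            then show ?thesis unfolding G T_def by (auto simp: dist_real_def)
          qed
          then show "t \<in> closure G" unfolding closure_approachable by simp
        qed
        moreover have "openin (top_of_set S) G"
          unfolding G Diff_eq using T_closed[of n] by (intro openin_open_Int) auto
        ultimately show "openin (top_of_set S) G \<and> S \<subseteq> closure G" by simp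
      qed (auto simp: S_def)
      have empty: "\<Inter>(range (\<lambda>n. S - T n)) = {}"
      proof (intro equals0I)
        fix t assume t: "t \<in> \<Inter>(range (\<lambda>n. S - T n))"
        then have "t \<in> S - T (nat \<lceil>\<bar>h t\<bar>\<rceil>)" by (rule InterD) (rule rangeI)
        then show False by (simp add: T_def)
      qed
      have "S \<subseteq> {}" using dense unfolding empty by simp
      moreover have "d \<in> D \<inter> {l<..<r}" using d lr by simp
      then have "d \<in> S" unfolding S_def by (rule subsetD[OF closure_subset])
      ultimately show False by blast
    qed
    then obtain n t0 \<epsilon>0 where t0: "t0 \<in> S" "\<epsilon>0 > 0"
      and n0: "\<And>u. u \<in> S \<Longrightarrow> \<bar>u - t0\<bar> < \<epsilon>0 \<Longrightarrow> \<bar>h u\<bar> \<le> real n" by blast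
    obtain t1 where "t1 \<in> D \<inter> {l<..<r}" "dist t1 t0 < \<epsilon>0"
      using t0 unfolding S_def closure_approachable by blast
    then have t1: "t1 \<in> D" "l < t1" "t1 < r" "\<bar>t1 - t0\<bar> < \<epsilon>0" by (simp_all add: dist_real_def)
    define \<epsilon> where "\<epsilon> = min (\<epsilon>0 - \<bar>t1 - t0\<bar>) (min (t1 - l) (r - t1)) / 2"
    have \<epsilon>: "\<epsilon> > 0" "\<epsilon> < \<epsilon>0 - \<bar>t1 - t0\<bar>" "l < t1 - \<epsilon>" "t1 + \<epsilon> < r"
    proof -
      have "min (\<epsilon>0 - \<bar>t1 - t0\<bar>) (min (t1 - l) (r - t1)) > 0" (is "?m > 0") using t1 by simp
      moreover have "?m \<le> \<epsilon>0 - \<bar>t1 - t0\<bar>" "?m \<le> t1 - l" "?m \<le> r - t1" by simp_all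
      moreover have "?m = 2 * \<epsilon>" by (simp add: \<epsilon>_def)
      ultimately show "\<epsilon> > 0" "\<epsilon> < \<epsilon>0 - \<bar>t1 - t0\<bar>" "l < t1 - \<epsilon>" "t1 + \<epsilon> < r" by linarith+
    qed
    have D_bound: "\<bar>h u\<bar> \<le> real n" if "u \<in> D" "\<bar>u - t1\<bar> \<le> \<epsilon>" for u
    proof -
      have "l < u" "u < r" "\<bar>u - t0\<bar> < \<epsilon>0" using that \<epsilon> by linarith+
      then have "u \<in> D \<inter> {l<..<r}" using that by simp
      then have "u \<in> S" unfolding S_def by (rule subsetD[OF closure_subset])
      then show ?thesis using n0 \<open>\<bar>u - t0\<bar> < \<epsilon>0\<close> by blast
    qed
    define M where "M = max (real n) (max \<bar>h (t1 - \<epsilon>)\<bar> \<bar>h (t1 + \<epsilon>)\<bar>)"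
    have "\<bar>h u\<bar> \<le> M" if u: "\<bar>u - t1\<bar> < \<epsilon>" for u
    proof -
      \<comment> \<open>\<open>Sup A\<close> and \<open>Inf B\<close> are the ends of the gap of \<open>D\<close> around \<open>u\<close>, cut
        off at distance \<open>\<epsilon>\<close> from \<open>t1\<close>.\<close>
      define A where "A = insert (t1 - \<epsilon>) (D \<inter> {t1 - \<epsilon>..u})"
      define B where "B = insert (t1 + \<epsilon>) (D \<inter> {u..t1 + \<epsilon>})"
      have "t1 - \<epsilon> \<in> {l..r}" "t1 + \<epsilon> \<in> {l..r}" "u \<in> {l..r}" using \<epsilon> u by auto
      then have in_J: "t1 - \<epsilon> \<in> J" "t1 + \<epsilon> \<in> J" "u \<in> J" using lr(1) by blast+
      have "closed A" "closed B" unfolding A_def B_def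
        by (intro closed_insert closed_D interval in_J)+
      moreover have ne: "A \<noteq> {}" "B \<noteq> {}" and bdd: "bdd_above A" "bdd_below B"
        by (simp_all add: A_def B_def)
      ultimately have ends: "Sup A \<in> A" "Inf B \<in> B"
        by (simp_all add: closed_contains_Sup closed_contains_Inf)
      have free: "w \<notin> D" if w: "Sup A < w" "w < Inf B" for w
      proof
        assume "w \<in> D"
        have "t1 - \<epsilon> \<le> Sup A" "Inf B \<le> t1 + \<epsilon>"
          by (rule cSup_upper[OF _ bdd(1)], simp add: A_def)
             (rule cInf_lower[OF _ bdd(2)], simp add: B_def)
        then have "w \<in> A \<or> w \<in> B" using \<open>w \<in> D\<close> w by (auto simp: A_def B_def)
        then show False
          using w cSup_upper[of w A] cInf_lower[of w B] bdd by auto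
      qed
      have "Sup A \<le> u" "u \<le> Inf B" using ends u by (auto simp: A_def B_def)
      moreover have "Sup A \<in> J" "Inf B \<in> J" using ends in_J by (auto simp: A_def B_def D_def)
      ultimately have "\<bar>h u\<bar> \<le> max \<bar>h (Sup A)\<bar> \<bar>h (Inf B)\<bar>"
        using free by (intro gap)
      moreover have "\<bar>h (Sup A)\<bar> \<le> M" "\<bar>h (Inf B)\<bar> \<le> M"
      proof -
        have "Sup A = t1 - \<epsilon> \<or> Sup A \<in> D \<and> \<bar>Sup A - t1\<bar> \<le> \<epsilon>" using ends(1) u by (auto simp: A_def)
        then show "\<bar>h (Sup A)\<bar> \<le> M" using D_bound[of "Sup A"] by (auto simp: M_def)
        have "Inf B = t1 + \<epsilon> \<or> Inf B \<in> D \<and> \<bar>Inf B - t1\<bar> \<le> \<epsilon>" using ends(2) u by (auto simp: B_def)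
        then show "\<bar>h (Inf B)\<bar> \<le> M" using D_bound[of "Inf B"] by (auto simp: M_def)
      qed
      ultimately show ?thesis by simp
    qed
    moreover obtain u where "\<bar>u - t1\<bar> < \<epsilon>" "\<bar>h u\<bar> > M"
      using t1(1) \<epsilon>(1) unfolding D_def by blast
    ultimately show False by (meson not_less)
  qed
  then show ?thesis using tame by (auto intro: continuous_at_imp_continuous_on)
qed

section \<open>Branches of an expanding curve\<close>

lemma homeomorphic_map_curve_topology:
  assumes "inj \<gamma>"
  shows "homeomorphic_map euclideanreal (curve_topology \<gamma>) \<gamma>"
proof -
  have top: "topspace (curve_topology \<gamma>) = range \<gamma>"
    by (simp add: curve_topology_def topspace_pullback_topology)
  show ?thesis
  proof (rule bijective_open_imp_homeomorphic_map)
    show "continuous_map euclideanreal (curve_topology \<gamma>) \<gamma>"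
      unfolding continuous_map_def top
    proof (intro conjI allI impI)
      fix U assume "openin (curve_topology \<gamma>) U"
      then obtain V where V: "open V" "U = \<gamma> ` V" using openin_curve_topology[OF assms] by blast
      then have "{x \<in> topspace euclideanreal. \<gamma> x \<in> U} = V" using inj_image_mem_iff[OF assms] by auto
      then show "openin euclideanreal {x \<in> topspace euclideanreal. \<gamma> x \<in> U}" using V(1) by simp
    qed simp
    show "open_map euclideanreal (curve_topology \<gamma>) \<gamma>"
      unfolding open_map_def using openin_curve_topology[OF assms] by auto
  qed (use assms top in auto)
qed

lemma connected_components_punctured_line:
  "connected_components_of (subtopology euclideanreal (- {t0})) = {{..<t0}, {t0<..}}"
proof -
  let ?X = "subtopology euclideanreal (- {t0})"
  have conn: "connectedin ?X {..<t0}" "connectedin ?X {t0<..}"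
    by (auto simp: connectedin_subtopology)
  have comp: "connected_component_of_set ?X x = (if x < t0 then {..<t0} else {t0<..})"
    if "x \<noteq> t0" for x
  proof (rule connected_component_of_unique)
    show "x \<in> (if x < t0 then {..<t0} else {t0<..})" using that by auto
    show "connectedin ?X (if x < t0 then {..<t0} else {t0<..})" using conn by simp
    fix C assume C: "x \<in> C \<and> connectedin ?X C"
    then have iv: "connected C" "t0 \<notin> C" by (auto simp: connectedin_subtopology)
    show "C \<subseteq> (if x < t0 then {..<t0} else {t0<..})"
    proof
      fix y assume y: "y \<in> C"
      have "\<not> (x \<le> t0 \<and> t0 \<le> y)" "\<not> (y \<le> t0 \<and> t0 \<le> x)"
        using connectedD_interval[OF iv(1), of x y t0] connectedD_interval[OF iv(1), of y x t0] iv(2) C y by auto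
      then show "y \<in> (if x < t0 then {..<t0} else {t0<..})" using that by auto
    qed
  qed
  have "connected_components_of ?X = (\<lambda>x. if x < t0 then {..<t0} else {t0<..}) ` (- {t0})"
    unfolding connected_components_of_def using comp by (intro image_cong) auto
  also have "\<dots> = {{..<t0}, {t0<..}}"
  proof (intro equalityI subsetI)
    fix S assume "S \<in> {{..<t0}, {t0<..}}"
    then consider "S = {..<t0}" | "S = {t0<..}" by blast
    then show "S \<in> (\<lambda>x. if x < t0 then {..<t0} else {t0<..}) ` (- {t0})"
    proof cases
      case 1
      then show ?thesis by (intro image_eqI[of _ _ "t0 - 1"]) simp_all
    next
      case 2
      then show ?thesis by (intro image_eqI[of _ _ "t0 + 1"]) simp_all
    qed
  qed auto
  finally show ?thesis .
qed

lemma connected_components_curve: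
  assumes "inj \<gamma>" and "range \<gamma> = W" and "\<gamma> t0 = p"
  shows "connected_components_of (subtopology (curve_topology \<gamma>) (W - {p})) =
    {\<gamma> ` {..<t0}, \<gamma> ` {t0<..}}"
proof -
  have "homeomorphic_map (subtopology euclideanreal (- {t0})) (subtopology (curve_topology \<gamma>) (W - {p})) \<gamma>"
  proof (rule homeomorphic_map_subtopologies[OF homeomorphic_map_curve_topology[OF assms(1)]])
    show "\<gamma> ` (topspace euclideanreal \<inter> - {t0}) = topspace (curve_topology \<gamma>) \<inter> (W - {p})"
      using assms by (auto simp: curve_topology_def topspace_pullback_topology inj_eq)
  qed
  from homeomorphic_map_connected_components_of[OF this] show ?thesis
    by (simp add: connected_components_punctured_line)
qed

lemma curve_parameterization_continuous:
  assumes "curve_parameterization \<gamma> W"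
  shows "continuous_on UNIV \<gamma>"
proof -
  obtain c c' where c: "\<And>t. \<gamma> t = torus_of (c t)" "\<And>t. (c has_vector_derivative c' t) (at t)"
    using assms unfolding curve_parameterization_def by blast
  have "continuous_on UNIV c"
    using c(2) by (intro continuous_at_imp_continuous_on ballI)
      (rule has_vector_derivative_continuous)
  then have "continuous_on UNIV (\<lambda>t. torus_of (c t))"
    by (rule continuous_on_compose2[OF continuous_torus_of[of UNIV]]) simp
  then show ?thesis by (simp add: c(1)[abs_def])
qed

text \<open>
  Although \<open>curve_branches\<close> collects the components for all parameterizations, they are the
  two halves of any one curve \<open>\<gamma>\<close> on which some continuous map acts by an expansion of the
  parameter.  For another parameterization \<open>\<delta>\<close> the change of parameter is continuous away from
  \<open>p\<close>: the expansion fixes only \<open>p\<close> on the curve.  So it sends each half-line of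
  \<open>\<delta>\<close> into one half-line of \<open>\<gamma>\<close>, and surjectivity forces these to be all of it.
  The point \<open>p\<close> itself is left out because an end of the curve might return to it.
\<close>

lemma curve_branches_eq:
  assumes \<gamma>: "curve_parameterization \<gamma> W" and \<gamma>0: "\<gamma> 0 = p"
    and \<phi>: "continuous_on UNIV \<phi>" "\<And>s. \<phi> (\<gamma> s) = \<gamma> (\<nu> * s)" "\<nu> > 1"
  shows "curve_branches W p = {\<gamma> ` {..<0}, \<gamma> ` {0<..}}"
proof -
  have inj: "inj \<gamma>" and range: "range \<gamma> = W" using \<gamma> by (auto simp: curve_parameterization_def)
  have p: "p \<in> W" using range \<gamma>0 by auto
  have "{\<delta> ` {..<t0}, \<delta> ` {t0<..}} = {\<gamma> ` {..<0}, \<gamma> ` {0<..}}"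
    if \<delta>: "curve_parameterization \<delta> W" and t0: "\<delta> t0 = p" for \<delta> t0
  proof -
    have injd: "inj \<delta>" and ranged: "range \<delta> = W" using \<delta> by (auto simp: curve_parameterization_def)
    define h where "h t = inv \<gamma> (\<delta> t)" for t
    have h: "\<gamma> (h t) = \<delta> t" for t
      unfolding h_def using range ranged by (intro f_inv_into_f) auto
    have h0: "h t = 0 \<longleftrightarrow> t = t0" for t
      using h[of t] \<gamma>0 t0 inj injd by (metis injD)
    have moved: "\<phi> (\<delta> t) \<noteq> \<delta> t" if "t \<noteq> t0" for t
    proof
      assume "\<phi> (\<delta> t) = \<delta> t"
      then have "\<gamma> (\<nu> * h t) = \<gamma> (h t)" using \<phi>(2)[of "h t"] h[of t] by simp
      then have "\<nu> * h t = h t" using inj by (metis injD)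
      then show False using \<phi>(3) h0 that by simp
    qed
    have cont: "continuous_on J h" if "open J" "convex J" "t0 \<notin> J" for J
    proof (rule continuous_change_of_parameter[OF curve_parameterization_continuous[OF \<gamma>] inj that(1,2),
          where \<delta> = \<delta> and \<phi> = \<phi> and \<nu> = \<nu>])
      show "continuous_on J \<delta>"
        using curve_parameterization_continuous[OF \<delta>] continuous_on_subset by blast
      show "inj_on \<delta> J" using injd inj_on_subset by blast
    next
      fix t assume "t \<in> J"
      then have "t \<noteq> t0" using that by blast
      then show "h t \<noteq> 0" "\<phi> (\<delta> t) \<noteq> \<delta> t" using h0 moved by auto
    qed (use h \<phi> in auto)
    have one_sided: "h ` J \<subseteq> {..<0} \<or> h ` J \<subseteq> {0<..}" if "open J" "convex J" "t0 \<notin> J" for J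
    proof -
      have "connected (h ` J)" using cont[OF that] that(2) convex_connected connected_continuous_image by blast
      moreover have "0 \<notin> h ` J" using h0 that(3) by fastforce
      ultimately show ?thesis unfolding connected_iff_interval
        by (smt (verit, best) greaterThan_iff lessThan_iff subsetI)
    qed
    have "surj h"
    proof (rule surjI)
      fix s
      show "h (inv \<delta> (\<gamma> s)) = s"
        using h[of "inv \<delta> (\<gamma> s)"] f_inv_into_f[of "\<gamma> s" \<delta> UNIV] range ranged inj
        by (metis injD rangeI)
    qed
    moreover have "UNIV = insert t0 ({..<t0} \<union> {t0<..})" by auto
    ultimately have cover: "h ` {..<t0} \<union> h ` {t0<..} \<union> {0} = UNIV"
      using h0[of t0] by (metis Un_insert_right image_Un image_insert sup_bot_right)
    have split: "A = N \<and> B = P \<or> A = P \<and> B = N"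
      if "A \<subseteq> N \<or> A \<subseteq> P" "B \<subseteq> N \<or> B \<subseteq> P" "N \<union> P \<subseteq> A \<union> B" "N \<inter> P = {}" "N \<noteq> {}" "P \<noteq> {}"
      for A B N P :: "real set"
      using that by blast
    have "h ` {..<t0} = {..<0} \<and> h ` {t0<..} = {0<..} \<or> h ` {..<t0} = {0<..} \<and> h ` {t0<..} = {..<0}"
    proof (rule split)
      show "h ` {..<t0} \<subseteq> {..<0} \<or> h ` {..<t0} \<subseteq> {0<..}" "h ` {t0<..} \<subseteq> {..<0} \<or> h ` {t0<..} \<subseteq> {0<..}"
        by (intro one_sided; simp)+
      show "{..<0} \<union> {0<..} \<subseteq> h ` {..<t0} \<union> h ` {t0<..}"
      proof
        fix s :: real assume "s \<in> {..<0} \<union> {0<..}"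
        then have "s \<noteq> 0" by auto
        then show "s \<in> h ` {..<t0} \<union> h ` {t0<..}" using cover by blast
      qed
    qed auto
    moreover have "\<delta> ` S = \<gamma> ` h ` S" for S by (simp add: image_image h)
    ultimately show ?thesis by auto
  qed
  moreover have "\<exists>t0. \<delta> t0 = p" if "curve_parameterization \<delta> W" for \<delta>
    using that p by (auto simp: curve_parameterization_def)
  ultimately have *: "connected_components_of (subtopology (curve_topology \<delta>) (W - {p})) =
      {\<gamma> ` {..<0}, \<gamma> ` {0<..}}" if "curve_parameterization \<delta> W" for \<delta>
    using that connected_components_curve[of \<delta> W _ p] unfolding curve_parameterization_def by metis
  show ?thesis
    unfolding curve_branches_def using * \<gamma> by auto
qed

section \<open>The graph transform\<close>

text \<open>
  Iteration of the graph transform: \<open>\<Phi>\<close> expands by about \<open>\<nu>\<close>, and the argument is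
  divided by \<open>\<nu>\<close>, so that first order terms are merely preserved.  Two successive iterates
  agree to first order at the origin, and on functions of size \<open>(norm s)\<^sup>2\<close> the transform
  contracts by about \<open>1 / \<nu>\<close>.
\<close>

lemma graph_transform_estimates:
  fixes \<Phi> :: "'a::real_normed_vector \<Rightarrow> 'a" and G :: "nat \<Rightarrow> 'b::real_normed_field \<Rightarrow> 'a"
    and \<nu> C :: real
  assumes \<nu>: "\<nu> > 1" and C: "C > 0" and \<delta>: "\<delta> > 0" and \<Phi>0: "\<Phi> 0 = 0"
    and lip: "\<And>r z w. r \<le> \<delta> \<Longrightarrow> norm z \<le> r \<Longrightarrow> norm w \<le> r \<Longrightarrow>
                norm (\<Phi> z - \<Phi> w) \<le> (\<nu> + C * r) * norm (z - w)"
    and G0: "\<And>s. norm (G 0 s) = norm s"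
    and GS: "\<And>n s. G (Suc n) s = \<Phi> (G n (s / of_real \<nu>))"
    and G1: "\<And>s. norm s \<le> \<delta> \<Longrightarrow> norm (G 1 s - G 0 s) \<le> C * (norm s)\<^sup>2"
  obtains \<rho> \<theta> where "\<rho> > 0" "0 < \<theta>" "\<theta> < 1"
    "\<And>n s. norm s \<le> \<rho> \<Longrightarrow> norm (G (Suc n) s - G n s) \<le> C * \<theta> ^ n * (norm s)\<^sup>2"
proof -
  \<comment> \<open>\<open>M\<close> is the solution of \<open>M / \<nu> + 4 * C / \<nu>\<^sup>2 = M\<close>, which makes the bound
    \<open>norm s + M * (norm s)\<^sup>2\<close> invariant; \<open>\<theta>\<close> lies halfway between the
    contraction rate \<open>1 / \<nu>\<close> of the linear part and \<open>1\<close>.\<close>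
  define M where "M = 4 * C / (\<nu> * (\<nu> - 1))"
  define \<theta> where "\<theta> = (1 + 1 / \<nu>) / 2"
  define \<rho> where "\<rho> = min (min (1 / M) (\<delta> / 2)) ((1 - 1 / \<nu>) * \<nu>\<^sup>2 / (4 * C))"
  have M: "M > 0" using \<nu> C by (simp add: M_def)
  have \<theta>: "0 < \<theta>" "\<theta> < 1" using \<nu> by (auto simp: \<theta>_def field_simps)
  have \<rho>: "\<rho> > 0" using M \<nu> \<delta> C by (simp add: \<rho>_def)
  have \<rho>_le: "t \<le> 1 / M" "2 * t \<le> \<delta>" "t \<le> (1 - 1 / \<nu>) * \<nu>\<^sup>2 / (4 * C)" if "t \<le> \<rho>" for t
    using that by (auto simp: \<rho>_def)
  have shrink: "norm (s / of_real \<nu>) = norm s / \<nu>" for s :: 'b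
    using \<nu> by (simp add: norm_divide)
  have grow: "norm (G n s) \<le> norm s + M * (norm s)\<^sup>2" if "norm s \<le> \<rho>" for n s
    using that
  proof (induction n arbitrary: s)
    case 0
    then show ?case using G0 M by simp
  next
    case (Suc n)
    define t where "t = norm s"
    have t: "0 \<le> t" "t \<le> \<rho>" using Suc.prems by (auto simp: t_def)
    have t\<nu>: "t / \<nu> \<le> t" using t \<nu> mult_right_mono[of 1 \<nu> t] by (simp add: field_simps)
    define u where "u = norm (G n (s / of_real \<nu>))"
    have u1: "u \<le> t / \<nu> + M * (t / \<nu>)\<^sup>2"
      unfolding u_def using Suc.IH[of "s / of_real \<nu>"] t t\<nu> by (simp add: shrink t_def)
    have "M * (t / \<nu>) \<le> 1"
    proof -
      have "M * (t / \<nu>) \<le> M * t" using t\<nu> M by (intro mult_left_mono) auto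
      also have "\<dots> \<le> 1" using \<rho>_le(1)[OF t(2)] M by (simp add: field_simps)
      finally show ?thesis .
    qed
    then have "M * (t / \<nu>) * (t / \<nu>) \<le> 1 * (t / \<nu>)"
      using t \<nu> by (intro mult_right_mono) auto
    then have u2: "u \<le> 2 * (t / \<nu>)" using u1 by (simp add: power2_eq_square)
    have u0: "0 \<le> u" by (simp add: u_def)
    have "norm (G (Suc n) s) \<le> (\<nu> + C * u) * u"
      using lip[of u "G n (s / of_real \<nu>)" 0] \<rho>_le(2)[OF t(2)] u2 t\<nu> \<Phi>0
      by (simp add: GS u_def)
    also have "\<dots> = \<nu> * u + C * u\<^sup>2" by (simp add: power2_eq_square algebra_simps)
    also have "\<dots> \<le> \<nu> * (t / \<nu> + M * (t / \<nu>)\<^sup>2) + C * (2 * (t / \<nu>))\<^sup>2"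
      using u0 u1 u2 \<nu> C by (intro add_mono mult_left_mono power_mono) auto
    also have "\<dots> = t + M * t\<^sup>2"
      using \<nu> C by (simp add: M_def field_simps power2_eq_square)
    finally show ?case by (simp add: t_def)
  qed
  have small: "norm (G n s) \<le> 2 * norm s" if "norm s \<le> \<rho>" for n s
  proof -
    have "M * norm s \<le> 1" using \<rho>_le(1)[OF that] M by (simp add: field_simps)
    then have "M * norm s * norm s \<le> 1 * norm s" by (intro mult_right_mono) auto
    then show ?thesis using grow[OF that, of n] by (simp add: power2_eq_square)
  qed
  have "norm (G (Suc n) s - G n s) \<le> C * \<theta> ^ n * (norm s)\<^sup>2" if "norm s \<le> \<rho>" for n s
    using that
  proof (induction n arbitrary: s)
    case 0
    have "norm s \<le> \<delta>" using \<rho>_le(2)[OF 0] norm_ge_zero[of s] by linarith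
    then show ?case using G1[of s] by simp
  next
    case (Suc n)
    define t where "t = norm s"
    have t: "0 \<le> t" "t \<le> \<rho>" using Suc.prems by (auto simp: t_def)
    have t\<nu>: "t / \<nu> \<le> t" using t \<nu> mult_right_mono[of 1 \<nu> t] by (simp add: field_simps)
    have s\<nu>: "norm (s / of_real \<nu>) \<le> \<rho>" using t t\<nu> by (simp add: shrink t_def)
    have "norm (G (Suc (Suc n)) s - G (Suc n) s)
        \<le> (\<nu> + C * (2 * (t / \<nu>))) * norm (G (Suc n) (s / of_real \<nu>) - G n (s / of_real \<nu>))"
      unfolding GS[of "Suc n" s] GS[of n s]
      using small[OF s\<nu>] \<rho>_le(2)[OF t(2)] t\<nu> by (intro lip) (simp_all add: shrink t_def)
    also have "\<dots> \<le> (\<nu> + C * (2 * (t / \<nu>))) * (C * \<theta> ^ n * (t / \<nu>)\<^sup>2)"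
      using Suc.IH[OF s\<nu>] \<nu> C t by (intro mult_left_mono) (simp_all add: shrink t_def)
    also have "\<dots> = ((\<nu> + C * (2 * (t / \<nu>))) / \<nu>\<^sup>2) * (C * \<theta> ^ n * t\<^sup>2)"
      by (simp add: power_divide)
    also have "\<dots> \<le> \<theta> * (C * \<theta> ^ n * t\<^sup>2)"
    proof (intro mult_right_mono)
      have "C * (2 * (t / \<nu>)) \<le> C * (2 * t)" using C t\<nu> by (intro mult_left_mono) auto
      also have "\<dots> \<le> (1 - 1 / \<nu>) * \<nu>\<^sup>2 / 2"
        using \<rho>_le(3)[OF t(2)] C by (simp add: field_simps)
      also have "\<dots> = \<theta> * \<nu>\<^sup>2 - \<nu>"
        using \<nu> by (simp add: \<theta>_def field_simps power2_eq_square)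
      finally have "\<nu> + C * (2 * (t / \<nu>)) \<le> \<theta> * \<nu>\<^sup>2" by simp
      then show "(\<nu> + C * (2 * (t / \<nu>))) / \<nu>\<^sup>2 \<le> \<theta>"
        using \<nu> by (simp add: divide_le_eq)
      show "0 \<le> C * \<theta> ^ n * t\<^sup>2" using C \<theta> by simp
    qed
    finally show ?case by (simp add: t_def mult_ac)
  qed
  with \<rho> \<theta> show thesis using that by blast
qed

text \<open>
  The iterates converge uniformly near the origin by comparison with a geometric series.
  Far from the origin the recursion expresses an iterate through the previous one at a smaller
  argument, so pointwise convergence spreads to the whole space.
\<close>

lemma graph_transform_limit:
  fixes \<Phi> :: "'a::banach \<Rightarrow> 'a" and G :: "nat \<Rightarrow> 'b::real_normed_field \<Rightarrow> 'a"
    and \<nu> C :: real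
  assumes \<nu>: "\<nu> > 1" and C: "C > 0" and \<delta>: "\<delta> > 0" and \<Phi>0: "\<Phi> 0 = 0"
    and cont: "continuous_on UNIV \<Phi>"
    and lip: "\<And>r z w. r \<le> \<delta> \<Longrightarrow> norm z \<le> r \<Longrightarrow> norm w \<le> r \<Longrightarrow>
                norm (\<Phi> z - \<Phi> w) \<le> (\<nu> + C * r) * norm (z - w)"
    and G0: "\<And>s. norm (G 0 s) = norm s"
    and GS: "\<And>n s. G (Suc n) s = \<Phi> (G n (s / of_real \<nu>))"
    and G1: "\<And>s. norm s \<le> \<delta> \<Longrightarrow> norm (G 1 s - G 0 s) \<le> C * (norm s)\<^sup>2"
  obtains H \<rho> M where "\<rho> > 0" "\<And>s. (\<lambda>n. G n s) \<longlonglongrightarrow> H s"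
    "uniform_limit (cball 0 \<rho>) G H sequentially"
    "\<And>s. H s = \<Phi> (H (s / of_real \<nu>))"
    "\<And>s. norm s \<le> \<rho> \<Longrightarrow> norm (H s - G 0 s) \<le> M * (norm s)\<^sup>2"
proof -
  obtain \<rho> \<theta> where \<rho>: "\<rho> > 0" and \<theta>: "0 < \<theta>" "\<theta> < 1"
    and step: "\<And>n s. norm s \<le> \<rho> \<Longrightarrow> norm (G (Suc n) s - G n s) \<le> C * \<theta> ^ n * (norm s)\<^sup>2"
    by (rule graph_transform_estimates[where \<Phi> = \<Phi> and G = G, OF \<nu> C \<delta> \<Phi>0])
       (assumption | rule lip G0 GS G1 that)+
  define L where "L s = G 0 s + (\<Sum>n. G (Suc n) s - G n s)" for s
  have sums: "G 0 s + (\<Sum>j<n. G (Suc j) s - G j s) = G n s" for n s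
    using sum_lessThan_telescope[of "\<lambda>j. G j s" n] by simp
  have "uniform_limit (cball 0 \<rho>) (\<lambda>n s. \<Sum>j<n. G (Suc j) s - G j s)
          (\<lambda>s. \<Sum>n. G (Suc n) s - G n s) sequentially"
  proof (rule Weierstrass_m_test)
    show "norm (G (Suc n) s - G n s) \<le> C * \<rho>\<^sup>2 * \<theta> ^ n" if "s \<in> cball 0 \<rho>" for n s
    proof -
      have "norm (G (Suc n) s - G n s) \<le> C * \<theta> ^ n * (norm s)\<^sup>2" using step that by simp
      also have "\<dots> \<le> C * \<theta> ^ n * \<rho>\<^sup>2"
        using that C \<theta> by (intro mult_left_mono power_mono) auto
      finally show ?thesis by (simp add: mult_ac)
    qed
    show "summable (\<lambda>n. C * \<rho>\<^sup>2 * \<theta> ^ n)"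
      using \<theta> by (intro summable_mult summable_geometric) simp
  qed
  then have "uniform_limit (cball 0 \<rho>) (\<lambda>n s. G 0 s + (\<Sum>j<n. G (Suc j) s - G j s)) L sequentially"
    unfolding L_def by (intro uniform_limit_add uniform_limit_const)
  then have uni: "uniform_limit (cball 0 \<rho>) G L sequentially" by (simp add: sums)
  have conv: "convergent (\<lambda>n. G n s)" if "norm s \<le> \<rho> * \<nu> ^ m" for m s
    using that
  proof (induction m arbitrary: s)
    case 0
    then have "(\<lambda>n. G n s) \<longlonglongrightarrow> L s" using tendsto_uniform_limitI[OF uni] by simp
    then show ?case by (rule convergentI)
  next
    case (Suc m)
    then have "norm (s / of_real \<nu>) \<le> \<rho> * \<nu> ^ m"
      using \<nu> by (simp add: norm_divide divide_le_eq mult_ac)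
    then obtain l where "(\<lambda>n. G n (s / of_real \<nu>)) \<longlonglongrightarrow> l"
      using Suc.IH by (auto simp: convergent_def)
    then have "(\<lambda>n. \<Phi> (G n (s / of_real \<nu>))) \<longlonglongrightarrow> \<Phi> l"
      by (intro continuous_on_tendsto_compose[OF cont]) auto
    then have "(\<lambda>n. G (Suc n) s) \<longlonglongrightarrow> \<Phi> l" by (simp add: GS)
    then have "(\<lambda>n. G n s) \<longlonglongrightarrow> \<Phi> l" by (rule LIMSEQ_imp_Suc)
    then show ?case by (rule convergentI)
  qed
  define H where "H s = lim (\<lambda>n. G n s)" for s
  have H: "(\<lambda>n. G n s) \<longlonglongrightarrow> H s" for s
  proof -
    obtain m where "norm s / \<rho> < \<nu> ^ m" using real_arch_pow[OF \<nu>] by blast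
    then have "norm s \<le> \<rho> * \<nu> ^ m" using \<rho> by (simp add: field_simps)
    then show ?thesis unfolding H_def using conv convergent_LIMSEQ_iff by blast
  qed
  have HL: "H s = L s" if "s \<in> cball 0 \<rho>" for s
    using LIMSEQ_unique[OF H tendsto_uniform_limitI[OF uni that]] .
  have "uniform_limit (cball 0 \<rho>) G H sequentially"
    using uni by (rule uniform_limit_cong'[THEN iffD1, rotated -1]) (auto simp: HL)
  moreover have "H s = \<Phi> (H (s / of_real \<nu>))" for s
  proof -
    have "(\<lambda>n. \<Phi> (G n (s / of_real \<nu>))) \<longlonglongrightarrow> \<Phi> (H (s / of_real \<nu>))"
      using H by (intro continuous_on_tendsto_compose[OF cont]) auto
    moreover have "(\<lambda>n. \<Phi> (G n (s / of_real \<nu>))) \<longlonglongrightarrow> H s"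
      using LIMSEQ_Suc[OF H[of s]] by (simp add: GS)
    ultimately show ?thesis by (rule LIMSEQ_unique[rotated])
  qed
  moreover have "norm (H s - G 0 s) \<le> C / (1 - \<theta>) * (norm s)\<^sup>2" if s: "norm s \<le> \<rho>" for s
  proof (rule LIMSEQ_le_const2)
    show "(\<lambda>n. norm (G n s - G 0 s)) \<longlonglongrightarrow> norm (H s - G 0 s)"
      by (intro tendsto_intros H)
    have "norm (G n s - G 0 s) \<le> C / (1 - \<theta>) * (norm s)\<^sup>2" for n
    proof -
      have "norm (G n s - G 0 s) = norm (\<Sum>j<n. G (Suc j) s - G j s)"
        by (simp flip: sums[where n = n and s = s])
      also have "\<dots> \<le> (\<Sum>j<n. C * \<theta> ^ j * (norm s)\<^sup>2)"
        by (intro sum_norm_le step s)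
      also have "\<dots> = C * (norm s)\<^sup>2 * (\<Sum>j<n. \<theta> ^ j)"
        unfolding sum_distrib_left by (intro sum.cong) (auto simp: mult_ac)
      also have "\<dots> \<le> C * (norm s)\<^sup>2 * (1 / (1 - \<theta>))"
      proof (intro mult_left_mono)
        show "(\<Sum>j<n. \<theta> ^ j) \<le> 1 / (1 - \<theta>)"
          using \<theta> by (simp add: sum_gp_strict divide_right_mono)
      qed (use C in auto)
      finally show ?thesis by simp
    qed
    then show "\<exists>N. \<forall>n\<ge>N. norm (G n s - G 0 s) \<le> C / (1 - \<theta>) * (norm s)\<^sup>2" by blast
  qed
  ultimately show thesis using that \<rho> H by blast
qed

section \<open>Entire solutions of the unstable equation\<close>

text \<open>
  Two applications of the mean value inequality, first to the derivative of \<open>N\<close>.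
\<close>

lemma flat_holomorphic_lipschitz:
  assumes hol: "N holomorphic_on UNIV" and d0: "deriv N 0 = 0"
  obtains C where "C > 0"
    "\<And>r z w. r \<le> 1 \<Longrightarrow> norm z \<le> r \<Longrightarrow> norm w \<le> r \<Longrightarrow> norm (N z - N w) \<le> C * r * norm (z - w)"
proof -
  have hol1: "deriv N holomorphic_on UNIV" and hol2: "deriv (deriv N) holomorphic_on UNIV"
    using hol by (auto intro!: holomorphic_deriv)
  have "bounded (deriv (deriv N) ` cball 0 1)"
    by (intro compact_imp_bounded compact_continuous_image
        holomorphic_on_imp_continuous_on[OF holomorphic_on_subset[OF hol2]]) auto
  then obtain C where C: "C > 0" "\<And>z. norm z \<le> 1 \<Longrightarrow> norm (deriv (deriv N) z) \<le> C"
    unfolding bounded_pos by (auto simp: image_iff)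
  have DN: "(N has_field_derivative deriv N z) (at z within S)" for z S
    using hol by (simp add: holomorphic_derivI)
  have DDN: "(deriv N has_field_derivative deriv (deriv N) z) (at z within S)" for z S
    using hol1 by (simp add: holomorphic_derivI)
  have deriv_le: "norm (deriv N z) \<le> C * norm z" if "norm z \<le> 1" for z
    using field_differentiable_bound[of "cball 0 1" "deriv N" "deriv (deriv N)" C z 0] DDN C that d0 by simp
  show thesis
  proof (rule that[OF C(1)])
    fix r :: real and z w :: complex
    assume r: "r \<le> 1" and zw: "norm z \<le> r" "norm w \<le> r"
    show "norm (N z - N w) \<le> C * r * norm (z - w)"
    proof (rule field_differentiable_bound[where S = "cball 0 r" and f' = "deriv N"])
      fix y :: complex assume "y \<in> cball 0 r"
      then have "norm (deriv N y) \<le> C * norm y" "C * norm y \<le> C * r"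
        using deriv_le[of y] r C by auto
      then show "norm (deriv N y) \<le> C * r" by linarith
    qed (use DN zw in auto)
  qed
qed

lemmas holomorphic_on_compose2 = holomorphic_on_compose_gen[unfolded o_def]

text \<open>
  The second-order equation becomes a first-order one for the pair
  \<open>P s = X s - X (s / \<nu>) / \<nu>\<close> and \<open>Q s = X s - \<nu> * X (s / \<nu>)\<close>, whose linear part is
  diagonal with eigenvalues \<open>\<nu>\<close> and \<open>1 / \<nu>\<close>.  The graph transform, started at the
  eigendirection \<open>(s, 0)\<close>, converges to it.  Working over the complex numbers makes
  differentiability free: a locally uniform limit of holomorphic functions is holomorphic, and
  the functional equation extends holomorphy from a disc to the plane.
\<close>

lemma entire_unstable_solution:
  fixes N :: "complex \<Rightarrow> complex" and \<nu> :: real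
  assumes \<nu>: "\<nu> > 1" and hol: "N holomorphic_on UNIV" and d0: "deriv N 0 = 0"
    and odd: "\<And>z. N (- z) = - N z" and real: "\<And>z. z \<in> \<real> \<Longrightarrow> N z \<in> \<real>"
  obtains X where "X holomorphic_on UNIV" "deriv X 0 = of_real (\<nu> / (\<nu> - 1 / \<nu>))"
    "\<And>z. X (- z) = - X z" "\<And>z. z \<in> \<real> \<Longrightarrow> X z \<in> \<real>"
    "\<And>z. X (of_real \<nu> * z) + X (z / of_real \<nu>) = of_real (\<nu> + 1 / \<nu>) * X z + N (X z)"
proof -
  define v where "v = complex_of_real \<nu>"
  have v: "v \<noteq> 0" "v - 1 / v \<noteq> 0" "norm v = \<nu>" "v \<in> \<real>"
  proof -
    show "v - 1 / v \<noteq> 0"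
    proof
      assume "v - 1 / v = 0"
      then have "complex_of_real (\<nu> * \<nu>) = 1" using \<nu> by (simp add: v_def field_simps)
      then have "\<nu> * \<nu> = 1" using of_real_eq_1_iff by blast
      moreover have "\<nu> * \<nu> > 1 * 1" using \<nu> by (intro mult_strict_mono) auto
      ultimately show False by simp
    qed
  qed (use \<nu> in \<open>auto simp: v_def\<close>)
  have \<nu>': "\<nu> - 1 / \<nu> > 0" using \<nu> by (smt (verit) divide_less_eq_1_pos)
  have norm_v': "norm (v - 1 / v) = \<nu> - 1 / \<nu>"
  proof -
    have "v - 1 / v = of_real (\<nu> - 1 / \<nu>)" by (simp add: v_def)
    then show ?thesis using \<nu>' by (metis abs_of_pos norm_of_real)
  qed
  have N0: "N 0 = 0" using odd[of 0] by simp
  obtain C0 where C0: "C0 > 0" and lipN: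
    "\<And>r z w. r \<le> 1 \<Longrightarrow> norm z \<le> r \<Longrightarrow> norm w \<le> r \<Longrightarrow> norm (N z - N w) \<le> C0 * r * norm (z - w)"
    using flat_holomorphic_lipschitz[OF hol d0] by metis
  have contN: "continuous_on UNIV N" using hol by (rule holomorphic_on_imp_continuous_on)
  \<comment> \<open>\<open>\<xi>\<close> recovers \<open>X s\<close> from the pair \<open>(P s, Q s)\<close>.\<close>
  define \<xi> where "\<xi> z = (v * fst z - snd z / v) / (v - 1 / v)" for z :: "complex \<times> complex"
  define \<Phi> where "\<Phi> z = (v * fst z + N (\<xi> z), snd z / v + N (\<xi> z))" for z
  define G where "G = rec_nat (\<lambda>s. (s, 0)) (\<lambda>_ g s. \<Phi> (g (s / of_real \<nu>)))"
  have G_0: "G 0 s = (s, 0)" and G_Suc: "G (Suc n) s = \<Phi> (G n (s / of_real \<nu>))" for n s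
    by (simp_all add: G_def)
  define K where "K = (\<nu> + 1 / \<nu>) / (\<nu> - 1 / \<nu>)"
  have K: "K > 0" using \<nu> \<nu>' by (simp add: K_def add_pos_pos)
  have \<xi>_diff: "\<xi> z - \<xi> w = \<xi> (z - w)" for z w
    unfolding \<xi>_def diff_divide_distrib[symmetric, of _ "v - 1 / v"]
    by (rule arg_cong[of _ _ "\<lambda>y. y / (v - 1 / v)"]) (simp add: diff_divide_distrib right_diff_distrib)
  have \<xi>_le: "norm (\<xi> z) \<le> K * norm z" for z
  proof -
    have "norm (v * fst z - snd z / v) \<le> norm (v * fst z) + norm (snd z / v)"
      by (rule norm_triangle_ineq4)
    also have "\<dots> = \<nu> * norm (fst z) + norm (snd z) / \<nu>" by (simp add: norm_mult norm_divide v)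
    also have "\<dots> \<le> \<nu> * norm z + norm z / \<nu>"
      using \<nu> norm_fst_le[of "fst z" "snd z"] norm_snd_le[of "snd z" "fst z"]
      by (intro add_mono mult_left_mono divide_right_mono) auto
    also have "\<dots> = (\<nu> + 1 / \<nu>) * norm z" by (simp add: algebra_simps)
    finally show ?thesis
      using \<nu>' by (simp add: \<xi>_def norm_divide norm_v' K_def divide_right_mono)
  qed
  have linear_le: "norm (v * p, q / v) \<le> \<nu> * norm (p, q)" for p q :: complex
  proof -
    have "\<nu> * 1 \<ge> 1 / \<nu>" using \<nu> \<nu>' by simp
    then have "norm (q / v) \<le> \<nu> * norm q"
      using mult_right_mono[of "1 / \<nu>" \<nu> "norm q"] by (simp add: norm_divide v)
    then have "(norm (v * p))\<^sup>2 + (norm (q / v))\<^sup>2 \<le> (\<nu> * norm p)\<^sup>2 + (\<nu> * norm q)\<^sup>2"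
      using \<nu> by (intro add_mono power_mono) (auto simp: norm_mult v)
    also have "\<dots> = \<nu>\<^sup>2 * ((norm p)\<^sup>2 + (norm q)\<^sup>2)" by (simp add: power_mult_distrib algebra_simps)
    finally have "sqrt ((norm (v * p))\<^sup>2 + (norm (q / v))\<^sup>2) \<le> sqrt (\<nu>\<^sup>2 * ((norm p)\<^sup>2 + (norm q)\<^sup>2))"
      by (rule real_sqrt_le_mono)
    then show ?thesis using \<nu> by (simp add: norm_Pair real_sqrt_mult)
  qed
  have lip: "norm (\<Phi> z - \<Phi> w) \<le> (\<nu> + 2 * C0 * K\<^sup>2 * r) * norm (z - w)"
    if r: "r \<le> 1 / K" "norm z \<le> r" "norm w \<le> r" for r z w
  proof -
    let ?d = "N (\<xi> z) - N (\<xi> w)"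
    have Kr: "K * r \<le> 1" using r(1) K by (simp add: field_simps)
    have "norm (\<xi> z) \<le> K * r" "norm (\<xi> w) \<le> K * r"
      using \<xi>_le[of z] \<xi>_le[of w] r K by (smt (verit) mult_left_mono)+
    then have "norm ?d \<le> C0 * (K * r) * norm (\<xi> z - \<xi> w)" by (rule lipN[OF Kr])
    also have "\<dots> \<le> C0 * (K * r) * (K * norm (z - w))"
    proof -
      have "0 \<le> r" using r norm_ge_zero[of z] by linarith
      then show ?thesis unfolding \<xi>_diff using C0 K by (intro mult_left_mono \<xi>_le) auto
    qed
    finally have d: "norm ?d \<le> C0 * K\<^sup>2 * r * norm (z - w)" by (simp add: power2_eq_square mult_ac)
    have "\<Phi> z - \<Phi> w = (v * fst (z - w), snd (z - w) / v) + (?d, ?d)"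
      by (simp add: \<Phi>_def algebra_simps diff_divide_distrib)
    then have "norm (\<Phi> z - \<Phi> w) \<le> norm (v * fst (z - w), snd (z - w) / v) + norm (?d, ?d)"
      by (metis norm_triangle_ineq)
    also have "\<dots> \<le> \<nu> * norm (z - w) + (norm ?d + norm ?d)"
      using linear_le[of "fst (z - w)" "snd (z - w)", unfolded prod.collapse] norm_Pair_le[of ?d ?d]
      by (rule add_mono)
    also have "\<dots> \<le> \<nu> * norm (z - w) + 2 * (C0 * K\<^sup>2 * r * norm (z - w))" using d by simp
    finally show ?thesis by (simp add: algebra_simps)
  qed
  have G_1: "norm (G 1 s - G 0 s) \<le> 2 * C0 * K\<^sup>2 * (norm s)\<^sup>2" if s: "norm s \<le> 1 / K" for s
  proof -
    let ?y = "\<xi> (s / v, 0)"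
    have "G 1 s - G 0 s = (N ?y, N ?y)"
      using v by (simp add: G_0 G_Suc \<Phi>_def flip: v_def)
    then have "norm (G 1 s - G 0 s) \<le> 2 * norm (N ?y)"
      using norm_Pair_le[of "N ?y" "N ?y"] by simp
    have "norm (s / v, 0::complex) \<le> norm s"
      using \<nu> mult_left_mono[of 1 \<nu> "norm s"] by (simp add: norm_Pair norm_divide v divide_le_eq)
    then have y: "norm ?y \<le> K * norm s"
      using \<xi>_le[of "(s / v, 0)"] K by (smt (verit) mult_left_mono)
    have "K * norm s \<le> 1" using s K by (simp add: field_simps)
    then have "norm (N ?y) \<le> C0 * (K * norm s) * norm ?y"
      using lipN[of "K * norm s" ?y 0] y K N0 by simp
    also have "\<dots> \<le> C0 * (K * norm s) * (K * norm s)"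
      using y C0 K by (intro mult_left_mono) auto
    finally show ?thesis
      using \<open>norm (G 1 s - G 0 s) \<le> 2 * norm (N ?y)\<close> by (simp add: power2_eq_square mult_ac)
  qed
  have cont\<Phi>: "continuous_on UNIV \<Phi>"
    unfolding \<Phi>_def \<xi>_def
    by (intro continuous_intros continuous_on_compose2[OF contN]) (use v in auto)
  have \<Phi>0: "\<Phi> 0 = 0" by (simp add: \<Phi>_def \<xi>_def N0 zero_prod_def)
  have G_norm: "norm (G 0 s) = norm s" for s by (simp add: G_0 norm_Pair)
  have pos: "2 * C0 * K\<^sup>2 > 0" "1 / K > 0" using C0 K by auto
  obtain H \<rho> M where \<rho>: "\<rho> > 0" and lim: "\<And>s. (\<lambda>n. G n s) \<longlonglongrightarrow> H s"
    and uni: "uniform_limit (cball 0 \<rho>) G H sequentially"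
    and H: "\<And>s. H s = \<Phi> (H (s / of_real \<nu>))"
    and close: "\<And>s. norm s \<le> \<rho> \<Longrightarrow> norm (H s - G 0 s) \<le> M * (norm s)\<^sup>2"
    by (rule graph_transform_limit[OF \<nu> pos \<Phi>0 cont\<Phi> lip G_norm G_Suc G_1])
       (assumption | rule that)+
  define P Q where "P s = fst (H s)" and "Q s = snd (H s)" for s
  define X where "X s = \<xi> (H s)" for s
  have P: "P s = v * P (s / v) + N (X (s / v))" and Q: "Q s = Q (s / v) / v + N (X (s / v))" for s
    using H[of s] by (simp_all add: P_def Q_def X_def \<Phi>_def v_def)
  have X: "X s = (v * P s - Q s / v) / (v - 1 / v)" for s
    by (simp add: X_def P_def Q_def \<xi>_def)
  have holG: "(\<lambda>s. fst (G n s)) holomorphic_on UNIV \<and> (\<lambda>s. snd (G n s)) holomorphic_on UNIV" for n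
  proof (induction n)
    case 0
    then show ?case by (simp add: G_0)
  next
    case (Suc n)
    have sc: "(\<lambda>s. g (s / v)) holomorphic_on UNIV" if "g holomorphic_on UNIV" for g :: "complex \<Rightarrow> complex"
      using v(1) by (intro holomorphic_on_compose2[OF _ that] holomorphic_intros) auto
    have "(\<lambda>s. N (\<xi> (G n (s / v)))) holomorphic_on UNIV"
    proof -
      have "(\<lambda>s. \<xi> (G n (s / v))) holomorphic_on UNIV"
        unfolding \<xi>_def using v
        by (intro holomorphic_intros sc[OF conjunct1[OF Suc.IH]] sc[OF conjunct2[OF Suc.IH]]) auto
      then show ?thesis
        by (rule holomorphic_on_compose2[OF _ hol]) simp
    qed
    then show ?case
      unfolding G_Suc \<Phi>_def v_def[symmetric] fst_conv snd_conv using v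
      by (intro conjI holomorphic_intros sc[OF conjunct1[OF Suc.IH]] sc[OF conjunct2[OF Suc.IH]]) auto
  qed
  have holPQ: "P holomorphic_on ball 0 (\<rho> * \<nu> ^ m) \<and> Q holomorphic_on ball 0 (\<rho> * \<nu> ^ m)" for m
  proof (induction m)
    case 0
    have "uniform_limit (cball 0 \<rho>) (\<lambda>n s. fst (G n s)) P sequentially"
      "uniform_limit (cball 0 \<rho>) (\<lambda>n s. snd (G n s)) Q sequentially"
      unfolding P_def[abs_def] Q_def[abs_def]
      by (intro bounded_linear_uniform_limit_intros uni)+
    then have "P holomorphic_on ball 0 \<rho>" "Q holomorphic_on ball 0 \<rho>"
      using holG by (auto intro!: always_eventually elim!: holomorphic_uniform_limit[rotated]
          intro: holomorphic_on_imp_continuous_on holomorphic_on_subset)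
    then show ?case by simp
  next
    case (Suc m)
    have in_ball: "s / v \<in> ball 0 (\<rho> * \<nu> ^ m)" if "s \<in> ball 0 (\<rho> * \<nu> ^ Suc m)" for s
      using that \<nu> by (simp add: norm_divide v divide_less_eq mult_ac)
    have sc: "(\<lambda>s. g (s / v)) holomorphic_on ball 0 (\<rho> * \<nu> ^ Suc m)"
      if "g holomorphic_on ball 0 (\<rho> * \<nu> ^ m)" for g :: "complex \<Rightarrow> complex"
      using v(1) in_ball by (intro holomorphic_on_compose2[OF _ that] holomorphic_intros) auto
    have "X holomorphic_on ball 0 (\<rho> * \<nu> ^ m)"
      unfolding X[abs_def] using Suc.IH v by (intro holomorphic_intros) auto
    then have "(\<lambda>s. X (s / v)) holomorphic_on ball 0 (\<rho> * \<nu> ^ Suc m)" by (rule sc)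
    then have NX: "(\<lambda>s. N (X (s / v))) holomorphic_on ball 0 (\<rho> * \<nu> ^ Suc m)"
      by (rule holomorphic_on_compose2[OF _ hol]) simp
    have "(\<lambda>s. v * P (s / v) + N (X (s / v))) holomorphic_on ball 0 (\<rho> * \<nu> ^ Suc m)"
      "(\<lambda>s. Q (s / v) / v + N (X (s / v))) holomorphic_on ball 0 (\<rho> * \<nu> ^ Suc m)"
      using v by (intro holomorphic_intros NX sc conjunct1[OF Suc.IH] conjunct2[OF Suc.IH]; simp)+
    then show ?case by (simp only: P[symmetric] Q[symmetric])
  qed
  have entire: "P holomorphic_on UNIV" "Q holomorphic_on UNIV"
  proof -
    have "\<exists>m. s \<in> ball 0 (\<rho> * \<nu> ^ m)" for s :: complex
    proof -
      obtain m where "norm s / \<rho> < \<nu> ^ m" using real_arch_pow[OF \<nu>] by blast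
      then show ?thesis using \<rho> by (auto simp: field_simps)
    qed
    then have "(\<Union>m. ball 0 (\<rho> * \<nu> ^ m)) = (UNIV :: complex set)" by blast
    then show "P holomorphic_on UNIV" "Q holomorphic_on UNIV"
      using holPQ holomorphic_on_UN_open[where A = "\<lambda>m. ball 0 (\<rho> * \<nu> ^ m)" and I = UNIV] by (metis open_ball)+
  qed
  show thesis
  proof (rule that)
    show "X holomorphic_on UNIV"
      unfolding X[abs_def] using entire v by (intro holomorphic_intros) auto
    have \<xi>_odd: "\<xi> (- z) = - \<xi> z" for z
      using \<xi>_diff[of 0 z] by (simp add: \<xi>_def)
    have \<Phi>_odd: "\<Phi> (- z) = - \<Phi> z" for z by (simp add: \<Phi>_def \<xi>_odd odd)
    have G_odd: "G n (- s) = - G n s" for n s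
      by (induction n arbitrary: s) (simp_all add: G_0 G_Suc \<Phi>_odd)
    show "X (- z) = - X z" for z
    proof -
      have "(\<lambda>n. G n (- z)) \<longlonglongrightarrow> - H z" unfolding G_odd by (intro tendsto_intros lim)
      then have "H (- z) = - H z" using LIMSEQ_unique lim by blast
      then show ?thesis by (simp add: X_def \<xi>_odd)
    qed
    have G_real: "fst (G n s) \<in> \<real> \<and> snd (G n s) \<in> \<real>" if "s \<in> \<real>" for n s
      using that
    proof (induction n arbitrary: s)
      case (Suc n)
      then have IH: "fst (G n (s / v)) \<in> \<real>" "snd (G n (s / v)) \<in> \<real>" using v(4) by simp_all
      then have "\<xi> (G n (s / v)) \<in> \<real>"
        unfolding \<xi>_def by (intro Reals_divide Reals_diff Reals_mult v(4) Reals_1)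
      then have "N (\<xi> (G n (s / v))) \<in> \<real>" by (rule real)
      then show ?case
        unfolding G_Suc \<Phi>_def v_def[symmetric] fst_conv snd_conv
        by (intro conjI Reals_add Reals_mult Reals_divide IH v(4))
    qed (simp add: G_0)
    show "X z \<in> \<real>" if z: "z \<in> \<real>" for z
    proof -
      have "P z \<in> \<real>" unfolding P_def
        by (rule Lim_in_closed_set[OF closed_complex_Reals _ sequentially_bot tendsto_fst[OF lim]])
           (simp add: G_real[OF z])
      moreover have "Q z \<in> \<real>" unfolding Q_def
        by (rule Lim_in_closed_set[OF closed_complex_Reals _ sequentially_bot tendsto_snd[OF lim]])
           (simp add: G_real[OF z])
      ultimately show ?thesis
        unfolding X by (intro Reals_divide Reals_diff Reals_mult v(4) Reals_1)
    qed
    show "X (of_real \<nu> * z) + X (z / of_real \<nu>) = of_real (\<nu> + 1 / \<nu>) * X z + N (X z)" for z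
    proof -
      define D where "D = v - 1 / v"
      have D: "D \<noteq> 0" using v(2) by (simp add: D_def)
      have e1: "P (v * z) = v * P z + N (X z)" "Q (v * z) = Q z / v + N (X z)"
        using P[of "v * z"] Q[of "v * z"] v(1) by simp_all
      have "P z - Q z = D * X (z / v)"
        using P[of z] Q[of z] X[of "z / v"] v(2) by (simp add: D_def)
      then have e2: "X (z / v) = (P z - Q z) / D" using D by simp
      have "X (v * z) = (v * (v * P z + N (X z)) - (Q z / v + N (X z)) / v) / D"
        unfolding X[of "v * z"] e1 D_def ..
      also have "v * (v * P z + N (X z)) - (Q z / v + N (X z)) / v
          = v * v * P z - Q z / (v * v) + D * N (X z)"
        by (simp add: D_def algebra_simps add_divide_distrib)
      finally have e3: "X (v * z) = (v * v * P z - Q z / (v * v)) / D + N (X z)"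
        using D by (simp add: add_divide_distrib)
      have "(v * v * P z - Q z / (v * v)) / D + (P z - Q z) / D = (v + 1 / v) * X z"
        unfolding X[of z] D_def[symmetric] add_divide_distrib[symmetric] times_divide_eq_right
        by (rule arg_cong[of _ _ "\<lambda>y. y / D"]) (use v(1) in \<open>simp add: field_simps\<close>)
      then have "X (v * z) + X (z / v) = (v + 1 / v) * X z + N (X z)"
        unfolding e2 e3 by (simp add: algebra_simps)
      then show ?thesis by (simp add: v_def)
    qed
    have H0: "H 0 = 0" using close[of 0] \<rho> by (simp add: G_0 flip: zero_prod_def)
    have near: "norm (P s - s) \<le> M * (norm s)\<^sup>2" "norm (Q s) \<le> M * (norm s)\<^sup>2" if "norm s \<le> \<rho>" for s
    proof -
      have "norm (fst (H s - G 0 s)) \<le> norm (H s - G 0 s)" "norm (snd (H s - G 0 s)) \<le> norm (H s - G 0 s)"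
        by (metis norm_fst_le norm_snd_le prod.collapse)+
      then show "norm (P s - s) \<le> M * (norm s)\<^sup>2" "norm (Q s) \<le> M * (norm s)\<^sup>2"
        using close[OF that] by (simp_all add: P_def Q_def G_0)
    qed
    \<comment> \<open>The distance to the starting function is quadratic, so derivatives at the origin are
      those of the starting function.\<close>
    have D: "(g has_field_derivative c) (at 0)"
      if g: "g 0 = 0" "\<And>s. norm s \<le> \<rho> \<Longrightarrow> norm (g s - c * s) \<le> M * (norm s)\<^sup>2" for g :: "complex \<Rightarrow> complex" and c
    proof -
      have "((\<lambda>s. g s / s - c) \<longlongrightarrow> 0) (at 0)"
      proof (rule Lim_null_comparison)
        show "((\<lambda>s. M * norm s) \<longlongrightarrow> 0) (at (0::complex))" by (auto intro!: tendsto_eq_intros)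
        have "\<forall>\<^sub>F s::complex in at 0. norm s < \<rho>"
          using \<rho> by (auto simp: eventually_at intro!: exI[of _ \<rho>])
        moreover have "\<forall>\<^sub>F s::complex in at 0. s \<noteq> 0" by (simp add: eventually_at_filter)
        ultimately show "\<forall>\<^sub>F s in at 0. norm (g s / s - c) \<le> M * norm s"
        proof eventually_elim
          case (elim s)
          have "norm (g s / s - c) = norm (g s - c * s) / norm s"
            using elim by (simp add: field_simps flip: norm_divide)
          also have "\<dots> \<le> M * (norm s)\<^sup>2 / norm s"
            using g(2)[of s] elim by (intro divide_right_mono) auto
          finally show ?case using elim by (simp add: power2_eq_square)
        qed
      qed
      then have "((\<lambda>s. g s / s) \<longlongrightarrow> c) (at 0)" by (simp add: LIM_zero_iff)
      then show ?thesis by (simp add: has_field_derivative_iff g(1))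
    qed
    have "(P has_field_derivative 1) (at 0)" "(Q has_field_derivative 0) (at 0)"
      using near H0 by (auto intro!: D simp: P_def Q_def)
    then have "(X has_field_derivative (v * 1 - 0 / v) / (v - 1 / v)) (at 0)"
      unfolding X[abs_def] using v by (auto intro!: derivative_eq_intros)
    then show "deriv X 0 = of_real (\<nu> / (\<nu> - 1 / \<nu>))"
      by (simp add: DERIV_imp_deriv v_def)
  qed
qed

section \<open>The recurrence and the reversing symmetry of the standard map\<close>

text \<open>
  The linear part of the equation has the characteristic equation
  \<open>\<nu> + 1 / \<nu> = 2 + lam\<close>, the trace of the derivative of the standard map at \<open>p\<close>.
\<close>

lemma real_unstable_solution:
  assumes lam: "lam > 0"
  obtains \<nu> :: real and x x' :: "real \<Rightarrow> real"
  where "\<nu> > 1" "\<nu> + 1 / \<nu> = 2 + lam"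
    "\<And>s. (x has_real_derivative x' s) (at s)" "continuous_on UNIV x'" "x' 0 > 0"
    "\<And>s. x (- s) = - x s"
    "\<And>s. x (\<nu> * s) = 2 * x s - x (s / \<nu>) + lam / (2 * pi) * sin (2 * pi * x s)"
proof -
  define \<nu> where "\<nu> = (2 + lam + sqrt (lam\<^sup>2 + 4 * lam)) / 2"
  define g where "g z = of_real (lam / (2 * pi)) * sin (of_real (2 * pi) * z)" for z :: complex
  define N where "N z = g z - of_real lam * z" for z
  have sq: "(2 * \<nu> - 2 - lam)\<^sup>2 = lam\<^sup>2 + 4 * lam"
  proof -
    have "2 * \<nu> - 2 - lam = sqrt (lam\<^sup>2 + 4 * lam)" unfolding \<nu>_def by (simp only: field_simps) simp
    then show ?thesis using lam by simp
  qed
  have \<nu>: "\<nu> > 1"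
    using lam real_sqrt_gt_zero[of "lam\<^sup>2 + 4 * lam"] by (simp add: \<nu>_def add_pos_pos)
  have "\<nu> * \<nu> + 1 = (2 + lam) * \<nu>" using sq by (simp add: power2_eq_square algebra_simps)
  then have trace: "\<nu> + 1 / \<nu> = 2 + lam" using \<nu> by (simp add: field_simps)
  have "(N has_field_derivative 0) (at 0)"
    unfolding N_def g_def by (auto intro!: derivative_eq_intros simp: field_simps)
  then have dN: "deriv N 0 = 0" by (rule DERIV_imp_deriv)
  have holN: "N holomorphic_on UNIV"
    unfolding N_def g_def by (intro holomorphic_intros)
  have N_of_real: "N (of_real t) = of_real (lam / (2 * pi) * sin (2 * pi * t) - lam * t)" for t
    by (simp add: N_def g_def flip: sin_of_real)
  obtain X where X: "X holomorphic_on UNIV" and X'0: "deriv X 0 = of_real (\<nu> / (\<nu> - 1 / \<nu>))"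
    and odd: "\<And>z. X (- z) = - X z" and real: "\<And>z. z \<in> \<real> \<Longrightarrow> X z \<in> \<real>"
    and eq: "\<And>z. X (of_real \<nu> * z) + X (z / of_real \<nu>) = of_real (\<nu> + 1 / \<nu>) * X z + N (X z)"
  proof (rule entire_unstable_solution[OF \<nu> holN dN])
    show "N (- z) = - N z" for z by (simp add: N_def g_def)
    show "N z \<in> \<real>" if "z \<in> \<real>" for z using that N_of_real by (auto elim!: Reals_cases)
  qed (assumption | rule that)+
  define x x' where "x s = Re (X (of_real s))" and "x' s = Re (deriv X (of_real s))" for s :: real
  have X_real: "X (of_real s) = of_real (x s)" for s
    using real[of "of_real s"] by (auto simp: x_def elim!: Reals_cases)
  show thesis
  proof (rule that[OF \<nu> trace])
    show "(x has_real_derivative x' s) (at s)" for s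
    proof -
      have "(X has_field_derivative deriv X (of_real s)) (at (of_real s))"
        using X by (simp add: holomorphic_derivI)
      then have "((\<lambda>t. X (of_real t)) has_vector_derivative deriv X (of_real s)) (at s)"
        by (rule has_vector_derivative_real_field)
      then have "((\<lambda>t. Re (X (of_real t))) has_vector_derivative Re (deriv X (of_real s))) (at s)"
        by (rule bounded_linear.has_vector_derivative[OF bounded_linear_Re])
      then show ?thesis
        by (simp add: x_def[abs_def] x'_def has_real_derivative_iff_has_vector_derivative)
    qed
    have "continuous_on UNIV (deriv X)"
      using X by (intro holomorphic_on_imp_continuous_on holomorphic_deriv) auto
    then show "continuous_on UNIV x'"
      unfolding x'_def[abs_def] by (intro continuous_intros) (auto intro: continuous_on_compose2)
    have "\<nu> - 1 / \<nu> > 0" using \<nu> by (smt (verit) divide_less_eq_1_pos)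
    then show "x' 0 > 0" using \<nu> by (simp add: x'_def X'0)
    show "x (- s) = - x s" for s by (simp add: x_def odd)
    show "x (\<nu> * s) = 2 * x s - x (s / \<nu>) + lam / (2 * pi) * sin (2 * pi * x s)" for s
    proof -
      have "X (of_real (\<nu> * s)) + X (of_real (s / \<nu>)) = of_real (\<nu> + 1 / \<nu>) * X (of_real s) + N (X (of_real s))"
        using eq[of "of_real s"] by simp
      then have "complex_of_real (x (\<nu> * s) + x (s / \<nu>)) =
          of_real ((2 + lam) * x s + (lam / (2 * pi) * sin (2 * pi * x s) - lam * x s))"
        unfolding X_real N_of_real trace by simp
      then have "x (\<nu> * s) + x (s / \<nu>) = (2 + lam) * x s + (lam / (2 * pi) * sin (2 * pi * x s) - lam * x s)"
        by (simp only: of_real_eq_iff)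
      then show ?thesis by (simp add: algebra_simps)
    qed
  qed
qed

text \<open>
  A discrete maximum principle.  Where \<open>g\<close> is monotone, the difference of two solutions
  is convex as long as it is nonnegative, so once it leaves \<open>0\<close> it grows at least linearly.
\<close>

lemma bounded_solution_unique:
  fixes a b :: "nat \<Rightarrow> real" and g :: "real \<Rightarrow> real"
  assumes a: "\<And>n. a (Suc (Suc n)) = 2 * a (Suc n) - a n + g (a (Suc n))"
    and b: "\<And>n. b (Suc (Suc n)) = 2 * b (Suc n) - b n + g (b (Suc n))"
    and bound: "\<And>n. \<bar>a n\<bar> \<le> r" "\<And>n. \<bar>b n\<bar> \<le> r"
    and mono: "\<And>p q. \<bar>p\<bar> \<le> r \<Longrightarrow> \<bar>q\<bar> \<le> r \<Longrightarrow> p \<le> q \<Longrightarrow> g p \<le> g q"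
    and start: "a 0 = b 0"
  shows "a n = b n"
proof -
  have no_gap: "\<not> d (Suc 0) < e (Suc 0)"
    if d: "\<And>n. d (Suc (Suc n)) = 2 * d (Suc n) - d n + g (d (Suc n))"
    and e: "\<And>n. e (Suc (Suc n)) = 2 * e (Suc n) - e n + g (e (Suc n))"
    and bd: "\<And>n. \<bar>d n\<bar> \<le> r" "\<And>n. \<bar>e n\<bar> \<le> r" and eq0: "d 0 = e 0" for d e
  proof
    assume less: "d (Suc 0) < e (Suc 0)"
    define \<eta> where "\<eta> = e (Suc 0) - d (Suc 0)"
    have "e (Suc n) - d (Suc n) \<ge> e n - d n + \<eta> \<and> e n - d n \<ge> real n * \<eta>" for n
    proof (induction n)
      case 0
      then show ?case using eq0 by (simp add: \<eta>_def)
    next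
      case (Suc n)
      have "real (Suc n) * \<eta> \<ge> 0" using less by (simp add: \<eta>_def)
      then have "d (Suc n) \<le> e (Suc n)" using Suc.IH by (simp add: algebra_simps)
      then have "g (d (Suc n)) \<le> g (e (Suc n))" by (rule mono[OF bd])
      then show ?case using Suc.IH by (simp add: d[of n] e[of n] algebra_simps)
    qed
    moreover obtain m where "2 * r < real m * \<eta>"
      using reals_Archimedean3[of \<eta>] less by (auto simp: \<eta>_def)
    ultimately show False using bd(1)[of m] bd(2)[of m] by (smt (verit))
  qed
  have "a (Suc 0) = b (Suc 0)"
    using no_gap[of a b] no_gap[of b a] a b bound start by force
  then have "a n = b n \<and> a (Suc n) = b (Suc n)"
    by (induction n) (simp_all add: start a b)
  then show ?thesis by simp
qed

text \<open>
  In the coordinates (position, previous position), that is \<open>(x, x - y)\<close>, this is the swap;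
  it conjugates the standard map to its inverse because the recurrence for the positions is
  symmetric in time.
\<close>

lift_definition reversor :: "torus \<Rightarrow> torus" is "\<lambda>(x, y). (x - y, - y)"
proof -
  fix v w assume "torus_rel v w"
  then obtain m n :: int where "fst v = fst w + of_int m" "snd v = snd w + of_int n"
    by (rule torus_relE)
  moreover have "real_of_int m - real_of_int n \<in> \<int>" by (intro Ints_diff Ints_of_int)
  ultimately show "torus_rel (case v of (x, y) \<Rightarrow> (x - y, - y)) (case w of (x, y) \<Rightarrow> (x - y, - y))"
    by (simp add: torus_rel_def case_prod_beta)
qed

lemma reversor_reversor [simp]: "reversor (reversor z) = z"
  by transfer (auto simp: torus_rel_def)

lemma continuous_reversor: "continuous_on UNIV reversor"
proof -
  have "reversor \<circ> torus_of = (\<lambda>v. torus_of (fst v - snd v, - snd v))"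
    by (rule ext) (simp add: reversor.abs_eq case_prod_beta)
  then show ?thesis unfolding continuous_on_torus_iff
    by (simp only:) (intro continuous_on_compose2[OF continuous_torus_of[of UNIV]] continuous_intros; simp)
qed

lemma continuous_standard_map: "continuous_on UNIV (standard_map lam)"
proof -
  have "standard_map lam \<circ> torus_of = (\<lambda>v. torus_of (fst v + snd v + lam / (2 * pi) * sin (2 * pi * fst v),
      snd v + lam / (2 * pi) * sin (2 * pi * fst v)))"
    by (rule ext) (simp add: standard_map.abs_eq case_prod_beta)
  then show ?thesis unfolding continuous_on_torus_iff
    by (simp only:) (intro continuous_on_compose2[OF continuous_torus_of[of UNIV]] continuous_intros; simp)
qed

lemma inv_standard_map: "inv (standard_map lam) = standard_map_inv lam"
proof
  fix z
  have "standard_map lam (standard_map_inv lam z) = z"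
    by transfer (auto simp: torus_rel_def)
  then show "inv (standard_map lam) z = standard_map_inv lam z"
    by (intro inv_f_eq bij_is_inj bij_standard_map)
qed

lemma inv_standard_map_reversor: "inv (standard_map lam) (reversor z) = reversor (standard_map lam z)"
  unfolding inv_standard_map
  by transfer (auto simp: torus_rel_def algebra_simps)

lemma stable_manifold_eq_reversor:
  "stable_manifold (standard_map lam) (torus_of (0, 0)) =
   reversor ` unstable_manifold (standard_map lam) (torus_of (0, 0))"
proof -
  let ?f = "standard_map lam" and ?p = "torus_of (0, 0)"
  have conj: "(inv ?f ^^ n) (reversor z) = reversor ((?f ^^ n) z)" for n z
    by (induction n) (simp_all add: inv_standard_map_reversor)
  have p: "reversor ?p = ?p" by (simp add: reversor.abs_eq)
  have lim: "(\<lambda>n. reversor (X n)) \<longlonglongrightarrow> ?p" if "X \<longlonglongrightarrow> ?p" for X :: "nat \<Rightarrow> torus"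
    using continuous_on_tendsto_compose[OF continuous_reversor that] p by simp
  have "z \<in> stable_manifold ?f ?p \<longleftrightarrow> reversor z \<in> unstable_manifold ?f ?p" for z
    unfolding stable_manifold_def unstable_manifold_def mem_Collect_eq conj
    by (rule iffI; drule lim) simp_all
  then have *: "stable_manifold ?f ?p = reversor -` unstable_manifold ?f ?p" by blast
  show ?thesis unfolding *
  proof (intro equalityI subsetI)
    fix z assume "z \<in> reversor -` unstable_manifold ?f ?p"
    then show "z \<in> reversor ` unstable_manifold ?f ?p"
      by (intro image_eqI[of _ _ "reversor z"]) simp_all
  qed auto
qed

section \<open>The invariant curves and their homoclinic points\<close>

lemma Ints_diff_small:
  fixes a b :: real
  assumes "a - b \<in> \<int>" "\<bar>a - b\<bar> < 1"
  shows "a = b"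
  using Ints_nonzero_abs_less1[OF assms(1)] assms(2) by auto

text \<open>
  The first coordinate \<open>x\<close> of a parameterized unstable curve, on which the standard map
  multiplies the parameter by \<open>\<nu>\<close>.  The second coordinate of a point is the difference
  between its position and the preceding one, which lies at parameter \<open>s / \<nu>\<close>.
\<close>

locale unstable_solution =
  fixes lam \<nu> :: real and x x' :: "real \<Rightarrow> real"
  assumes lam: "lam > 0" and \<nu>: "\<nu> > 1" and trace: "\<nu> + 1 / \<nu> = 2 + lam"
    and DERIV_x: "\<And>s. (x has_real_derivative x' s) (at s)"
    and cont_x': "continuous_on UNIV x'" and x'0: "x' 0 > 0"
    and odd: "\<And>s. x (- s) = - x s"
    and x_step: "\<And>s. x (\<nu> * s) = 2 * x s - x (s / \<nu>) + lam / (2 * pi) * sin (2 * pi * x s)"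
begin

abbreviation f where "f \<equiv> standard_map lam"
abbreviation p where "p \<equiv> torus_of (0, 0)"

definition kick :: "real \<Rightarrow> real" where "kick t = lam / (2 * pi) * sin (2 * pi * t)"

definition lift_curve :: "real \<Rightarrow> real \<times> real" where "lift_curve s = (x s, x s - x (s / \<nu>))"

definition \<gamma> :: "real \<Rightarrow> torus" where "\<gamma> s = torus_of (lift_curve s)"

lemma x_step_kick: "x (\<nu> * s) = 2 * x s - x (s / \<nu>) + kick (x s)"
  by (simp add: kick_def x_step)

lemma f_torus_of: "f (torus_of (a, b)) = torus_of (a + b + kick a, b + kick a)"
  by (simp add: standard_map.abs_eq kick_def)

lemma inv_f_torus_of: "inv f (torus_of (a, b)) = torus_of (a - b, b - kick (a - b))"
  by (simp add: inv_standard_map standard_map_inv.abs_eq kick_def)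

lemma x_0: "x 0 = 0" using odd[of 0] by simp

lemma cont_x: "continuous_on UNIV x"
  using DERIV_x by (meson DERIV_isCont continuous_at_imp_continuous_on)

lemma kick_mono:
  assumes "\<bar>a\<bar> \<le> 1/4" "\<bar>b\<bar> \<le> 1/4" "a \<le> b"
  shows "kick a \<le> kick b"
proof -
  have "2 * pi * (- 1/4) \<le> 2 * pi * a" "2 * pi * a \<le> 2 * pi * b" "2 * pi * b \<le> 2 * pi * (1/4)"
    using assms by (intro mult_left_mono; simp)+
  then have "sin (2 * pi * a) \<le> sin (2 * pi * b)"
    by (intro sin_monotone_2pi_le) auto
  then show ?thesis using lam by (simp add: kick_def divide_right_mono)
qed

lemma kick_nonneg:
  assumes "0 \<le> a" "a \<le> 1/2"
  shows "0 \<le> kick a"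
proof -
  have "2 * pi * a \<le> 2 * pi * (1/2)" using assms by (intro mult_left_mono) auto
  then have "0 \<le> sin (2 * pi * a)" using assms by (intro sin_ge_zero) auto
  then show ?thesis using lam by (simp add: kick_def)
qed

lemma abs_kick_le: "\<bar>kick a\<bar> \<le> lam * \<bar>a\<bar>"
proof -
  have "\<bar>kick a\<bar> = lam / (2 * pi) * \<bar>sin (2 * pi * a)\<bar>" using lam by (simp add: kick_def abs_mult)
  also have "\<dots> \<le> lam / (2 * pi) * \<bar>2 * pi * a\<bar>"
    using lam by (intro mult_left_mono abs_sin_x_le_abs_x) auto
  finally show ?thesis by (simp add: abs_mult)
qed

lemma f_\<gamma>: "f (\<gamma> s) = \<gamma> (\<nu> * s)"
  using \<nu> by (simp add: \<gamma>_def lift_curve_def f_torus_of x_step_kick algebra_simps)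

lemma inv_f_\<gamma>: "inv f (\<gamma> s) = \<gamma> (s / \<nu>)"
proof -
  have "f (\<gamma> (s / \<nu>)) = \<gamma> s" using f_\<gamma>[of "s / \<nu>"] \<nu> by simp
  then show ?thesis by (intro inv_f_eq bij_is_inj bij_standard_map)
qed

lemma inv_f_pow_\<gamma>: "(inv f ^^ n) (\<gamma> s) = \<gamma> (s / \<nu> ^ n)"
  by (induction n) (simp_all add: inv_f_\<gamma> mult_ac)

lemma \<gamma>_0: "\<gamma> 0 = p"
  by (simp add: \<gamma>_def lift_curve_def x_0)

lemma continuous_\<gamma>: "continuous_on UNIV \<gamma>"
  unfolding \<gamma>_def[abs_def] lift_curve_def
  using \<nu> by (intro continuous_on_compose2[OF continuous_torus_of[of UNIV]] continuous_intros
      continuous_on_compose2[OF cont_x]) auto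

lemma shrink_to_0: "(\<lambda>n. s / \<nu> ^ n) \<longlonglongrightarrow> 0"
  by (rule LIMSEQ_divide_realpow_zero[OF \<nu>])

lemma x_near_0:
  assumes "\<eta> > 0"
  shows "\<exists>\<epsilon>>0. (\<forall>s. \<bar>s\<bar> \<le> \<epsilon> \<longrightarrow> \<bar>x s\<bar> < \<eta>) \<and>
    (\<forall>s t. \<bar>s\<bar> \<le> \<epsilon> \<and> \<bar>t\<bar> \<le> \<epsilon> \<and> s < t \<longrightarrow> x s < x t)"
proof -
  have "isCont x 0" "isCont x' 0"
    using cont_x cont_x' by (simp_all add: continuous_on_eq_continuous_at)
  then have lim: "x \<midarrow>0\<rightarrow> 0" "x' \<midarrow>0\<rightarrow> x' 0" by (simp_all add: isCont_def x_0)
  obtain d1 where d1: "d1 > 0" "\<And>s. \<bar>s\<bar> < d1 \<Longrightarrow> \<bar>x s\<bar> < \<eta>"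
    using LIM_D[OF lim(1) assms] assms x_0 by (metis diff_zero real_norm_def abs_zero)
  obtain d2 where d2: "d2 > 0" "\<And>s. \<bar>s\<bar> < d2 \<Longrightarrow> \<bar>x' s - x' 0\<bar> < x' 0"
    using LIM_D[OF lim(2) x'0] x'0 by (metis diff_zero real_norm_def abs_zero diff_self)
  define \<epsilon> where "\<epsilon> = min d1 d2 / 2"
  have \<epsilon>: "\<epsilon> > 0" "\<epsilon> < d1" "\<epsilon> < d2" using d1 d2 by (auto simp: \<epsilon>_def)
  have "\<bar>x s\<bar> < \<eta>" if "\<bar>s\<bar> \<le> \<epsilon>" for s using d1(2)[of s] that \<epsilon> by simp
  moreover have "x s < x t" if st: "\<bar>s\<bar> \<le> \<epsilon>" "\<bar>t\<bar> \<le> \<epsilon>" "s < t" for s t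
  proof (rule DERIV_pos_imp_increasing[OF st(3)])
    fix u assume "s \<le> u" "u \<le> t"
    then have "\<bar>u\<bar> < d2" using st \<epsilon> by auto
    then have "x' u > 0" using d2(2)[of u] by linarith
    then show "\<exists>y. (x has_real_derivative y) (at u) \<and> 0 < y" using DERIV_x by blast
  qed
  ultimately show ?thesis using \<epsilon>(1) by blast
qed

text \<open>
  Equality on the torus is carried backwards by the inverse map until both points are close to
  \<open>p\<close>; there representatives that differ by an integer vector agree, and \<open>x\<close> is
  strictly increasing.
\<close>

lemma inj_\<gamma>: "inj \<gamma>"
proof (rule injI)
  fix s t assume eq: "\<gamma> s = \<gamma> t"
  obtain \<epsilon> where \<epsilon>: "\<epsilon> > 0" "\<forall>s. \<bar>s\<bar> \<le> \<epsilon> \<longrightarrow> \<bar>x s\<bar> < 1/2"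
    "\<forall>s t. \<bar>s\<bar> \<le> \<epsilon> \<and> \<bar>t\<bar> \<le> \<epsilon> \<and> s < t \<longrightarrow> x s < x t"
    using x_near_0[OF half_gt_zero[OF zero_less_one]] by blast
  have "\<forall>\<^sub>F n in sequentially. \<bar>s / \<nu> ^ n\<bar> < \<epsilon> \<and> \<bar>t / \<nu> ^ n\<bar> < \<epsilon>"
    using tendstoD[OF shrink_to_0 \<epsilon>(1), of s] tendstoD[OF shrink_to_0 \<epsilon>(1), of t]
    by eventually_elim simp
  then obtain n where n: "\<bar>s / \<nu> ^ n\<bar> < \<epsilon>" "\<bar>t / \<nu> ^ n\<bar> < \<epsilon>"
    using eventually_happens'[OF sequentially_bot] by blast
  have "\<gamma> (s / \<nu> ^ n) = \<gamma> (t / \<nu> ^ n)" using inv_f_pow_\<gamma>[of n s] inv_f_pow_\<gamma>[of n t] eq by simp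
  then have "x (s / \<nu> ^ n) - x (t / \<nu> ^ n) \<in> \<int>"
    by (simp add: \<gamma>_def lift_curve_def torus_of_eq_iff torus_rel_def)
  moreover have "\<bar>x (s / \<nu> ^ n) - x (t / \<nu> ^ n)\<bar> < 1"
    using \<epsilon>(2)[rule_format, of "s / \<nu> ^ n"] \<epsilon>(2)[rule_format, of "t / \<nu> ^ n"] n by linarith
  ultimately have same: "x (s / \<nu> ^ n) = x (t / \<nu> ^ n)" by (rule Ints_diff_small)
  have "s / \<nu> ^ n = t / \<nu> ^ n"
  proof (rule linorder_cases)
    assume "s / \<nu> ^ n < t / \<nu> ^ n"
    then have "x (s / \<nu> ^ n) < x (t / \<nu> ^ n)"
      by (rule \<epsilon>(3)[rule_format, OF conjI[OF less_imp_le[OF n(1)] conjI[OF less_imp_le[OF n(2)]]]])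
    then show ?thesis using same by simp
  next
    assume "t / \<nu> ^ n < s / \<nu> ^ n"
    then have "x (t / \<nu> ^ n) < x (s / \<nu> ^ n)"
      by (rule \<epsilon>(3)[rule_format, OF conjI[OF less_imp_le[OF n(2)] conjI[OF less_imp_le[OF n(1)]]]])
    then show ?thesis using same by simp
  qed
  moreover have "\<nu> ^ n \<noteq> 0" using \<nu> by simp
  ultimately show "s = t" by (metis divide_cancel_right)
qed

lemma \<gamma>_in_unstable_manifold: "\<gamma> s \<in> unstable_manifold f p"
proof -
  have "(\<lambda>n. \<gamma> (s / \<nu> ^ n)) \<longlonglongrightarrow> \<gamma> 0"
    by (rule continuous_on_tendsto_compose[OF continuous_\<gamma> shrink_to_0]) auto
  then show ?thesis by (simp add: unstable_manifold_def inv_f_pow_\<gamma> \<gamma>_0)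
qed

text \<open>
  The given backward orbit and the one on the curve with the same initial position both solve
  the recurrence, read backwards, and both stay where \<open>kick\<close> is monotone, so the maximum
  principle identifies them.
\<close>

lemma small_backward_orbit_on_\<gamma>:
  assumes u: "\<And>n. u (Suc n) = u n - w n" and w: "\<And>n. w (Suc n) = w n - kick (u (Suc n))"
    and bound: "\<And>n. \<bar>u n\<bar> \<le> 1/4"
    and s: "x s = u 0" and x_small: "\<And>n. \<bar>x (s / \<nu> ^ n)\<bar> \<le> 1/4"
  shows "torus_of (u 0, w 0) = \<gamma> s"
proof -
  have "u n = x (s / \<nu> ^ n)" for n
  proof (rule bounded_solution_unique[where g = kick and r = "1/4"])
    show "u (Suc (Suc n)) = 2 * u (Suc n) - u n + kick (u (Suc n))" for n
      using u[of n] u[of "Suc n"] w[of n] by simp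
    show "x (s / \<nu> ^ Suc (Suc n)) = 2 * x (s / \<nu> ^ Suc n) - x (s / \<nu> ^ n) + kick (x (s / \<nu> ^ Suc n))" for n
    proof -
      have "\<nu> * (s / \<nu> ^ Suc n) = s / \<nu> ^ n" "s / \<nu> ^ Suc n / \<nu> = s / \<nu> ^ Suc (Suc n)"
        using \<nu> by (simp_all add: mult_ac)
      then show ?thesis using x_step[of "s / \<nu> ^ Suc n"] unfolding kick_def by (simp only:)
    qed
  qed (use bound x_small s kick_mono in auto)
  from this[of 1] have "w 0 = x s - x (s / \<nu>)" using u[of 0] s by simp
  then show ?thesis by (simp add: \<gamma>_def lift_curve_def s)
qed

text \<open>
  A backward orbit that converges to \<open>p\<close> is eventually represented in the box \<open>B\<close>,
  chosen so small that the representatives follow the lifted map without integer jumps and that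
  their positions are values of \<open>x\<close> near \<open>0\<close>.
\<close>

lemma range_\<gamma>: "range \<gamma> = unstable_manifold f p"
proof (intro equalityI subsetI)
  fix z assume "z \<in> unstable_manifold f p"
  then have lim: "(\<lambda>n. (inv f ^^ n) z) \<longlonglongrightarrow> p" by (simp add: unstable_manifold_def)
  have quarter: "(0::real) < 1/4" by simp
  obtain \<epsilon> where \<epsilon>: "\<epsilon> > 0" "\<forall>s. \<bar>s\<bar> \<le> \<epsilon> \<longrightarrow> \<bar>x s\<bar> < 1/4"
    "\<forall>s t. \<bar>s\<bar> \<le> \<epsilon> \<and> \<bar>t\<bar> \<le> \<epsilon> \<and> s < t \<longrightarrow> x s < x t"
    using x_near_0[OF quarter] by blast
  define b where "b = min (x \<epsilon>) (1 / (8 * (1 + lam)))"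
  have x\<epsilon>: "0 < x \<epsilon>" using \<epsilon>(3)[rule_format, of 0 \<epsilon>] \<epsilon>(1) x_0 by simp
  have b: "b > 0" using x\<epsilon> lam by (simp add: b_def)
  have "b * (1 + lam) \<le> 1 / (8 * (1 + lam)) * (1 + lam)"
    using lam by (intro mult_right_mono) (auto simp: b_def)
  also have "\<dots> = 1/8" using lam by (simp add: field_simps)
  finally have b_lam: "b * (1 + lam) \<le> 1/8" .
  then have b_le: "b \<le> 1/8" "lam * b \<le> 1/8"
    using b mult_pos_pos[OF lam b] unfolding distrib_left mult.commute[of lam] by linarith+
  define B where "B = {-b<..<b} \<times> {-b<..<b}"
  have "\<forall>\<^sub>F n in sequentially. (inv f ^^ n) z \<in> torus_of ` B"
    by (rule tendsto_torus_representatives[OF lim]) (use b in \<open>auto simp: B_def open_Times\<close>)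
  then obtain N where N: "\<And>n. n \<ge> N \<Longrightarrow> (inv f ^^ n) z \<in> torus_of ` B"
    by (auto simp: eventually_sequentially)
  have "\<exists>v. v \<in> B \<and> (inv f ^^ (n + N)) z = torus_of v" for n using N[of "n + N"] by auto
  then obtain v where v: "\<And>n. v n \<in> B" "\<And>n. (inv f ^^ (n + N)) z = torus_of (v n)" by metis
  define u w where "u n = fst (v n)" and "w n = snd (v n)" for n
  have uw: "\<bar>u n\<bar> < b" "\<bar>w n\<bar> < b" for n
    using v(1)[of n] by (auto simp: B_def u_def w_def mem_Times_iff)
  have v_uw: "torus_of (v n) = torus_of (u n, w n)" for n by (simp add: u_def w_def)
  have step: "u (Suc n) = u n - w n \<and> w (Suc n) = w n - kick (u (Suc n))" for n
  proof -
    have "torus_of (u (Suc n), w (Suc n)) = torus_of (u n - w n, w n - kick (u n - w n))"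
      using v(2)[of "Suc n"] v(2)[of n] by (simp add: v_uw inv_f_torus_of)
    then have ints: "u (Suc n) - (u n - w n) \<in> \<int>" "w (Suc n) - (w n - kick (u n - w n)) \<in> \<int>"
      by (simp_all add: torus_of_eq_iff torus_rel_def)
    have small: "\<bar>u n - w n\<bar> \<le> 2 * b" using uw[of n] by linarith
    have "\<bar>u (Suc n) - (u n - w n)\<bar> < 1" using uw[of "Suc n"] small b_le by linarith
    with ints(1) have 1: "u (Suc n) = u n - w n" by (rule Ints_diff_small)
    have "lam * \<bar>u n - w n\<bar> \<le> lam * (2 * b)" using small lam by (intro mult_left_mono) auto
    then have "\<bar>kick (u n - w n)\<bar> \<le> 1/4" using abs_kick_le[of "u n - w n"] b_le by linarith
    then have "\<bar>w (Suc n) - (w n - kick (u n - w n))\<bar> < 1"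
      using uw[of n] uw[of "Suc n"] b_le by linarith
    with ints(2) have "w (Suc n) = w n - kick (u n - w n)" by (rule Ints_diff_small)
    with 1 show ?thesis by simp
  qed
  have "\<exists>s\<ge>- \<epsilon>. s \<le> \<epsilon> \<and> x s = u 0"
  proof (rule IVT')
    show "x (- \<epsilon>) \<le> u 0" "u 0 \<le> x \<epsilon>" using uw(1)[of 0] by (auto simp: odd b_def)
  qed (use \<epsilon> cont_x in \<open>auto intro: continuous_on_subset\<close>)
  then obtain s where "- \<epsilon> \<le> s" "s \<le> \<epsilon>" and s: "x s = u 0" by blast
  then have s_le: "\<bar>s\<bar> \<le> \<epsilon>" by simp
  have "\<bar>s / \<nu> ^ n\<bar> \<le> \<epsilon>" for n
  proof -
    have "\<bar>s\<bar> / \<nu> ^ n \<le> \<bar>s\<bar> / 1" using \<nu> by (intro divide_left_mono) auto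
    then show ?thesis using s_le \<nu> by (simp add: abs_divide)
  qed
  then have "\<bar>x (s / \<nu> ^ n)\<bar> \<le> 1/4" for n using \<epsilon>(2)[rule_format] by (simp add: less_imp_le)
  moreover have "\<bar>u n\<bar> \<le> 1/4" for n using uw(1)[of n] b_le by linarith
  ultimately have "torus_of (u 0, w 0) = \<gamma> s"
    using step s by (intro small_backward_orbit_on_\<gamma>) auto
  then have "(inv f ^^ N) z = (inv f ^^ N) (\<gamma> (\<nu> ^ N * s))"
    using v(2)[of 0] \<nu> by (simp add: v_uw inv_f_pow_\<gamma>)
  moreover have "inj (inv f ^^ N)"
    by (intro bij_is_inj bij_betw_funpow bij_imp_bij_inv bij_standard_map)
  ultimately have "z = \<gamma> (\<nu> ^ N * s)" by (metis injD)
  then show "z \<in> range \<gamma>" by blast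
qed (use \<gamma>_in_unstable_manifold in auto)

definition lift_curve' :: "real \<Rightarrow> real \<times> real" where
  "lift_curve' s = (x' s, x' s - x' (s / \<nu>) / \<nu>)"

lemma lift_curve_derivative: "(lift_curve has_vector_derivative lift_curve' s) (at s)"
proof -
  have "((\<lambda>s. x (s / \<nu>)) has_real_derivative x' (s / \<nu>) * (1 / \<nu>)) (at s)"
    by (rule DERIV_chain2[OF DERIV_x]) (use \<nu> in \<open>auto intro!: derivative_eq_intros\<close>)
  then have "((\<lambda>s. x s - x (s / \<nu>)) has_real_derivative x' s - x' (s / \<nu>) / \<nu>) (at s)"
    using DERIV_diff[OF DERIV_x] by fastforce
  then show ?thesis
    unfolding lift_curve_def[abs_def] lift_curve'_def
    using DERIV_x[of s] by (intro has_vector_derivative_Pair)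
      (auto simp: has_real_derivative_iff_has_vector_derivative)
qed

lemma continuous_lift_curve': "continuous_on UNIV lift_curve'"
  unfolding lift_curve'_def[abs_def]
  using \<nu> by (intro continuous_intros cont_x' continuous_on_compose2[OF cont_x']) auto

lemma x'_step: "\<nu> * x' (\<nu> * s) = (2 + lam * cos (2 * pi * x s)) * x' s - x' (s / \<nu>) / \<nu>"
proof (rule DERIV_unique)
  have "((\<lambda>s. x (\<nu> * s)) has_real_derivative x' (\<nu> * s) * \<nu>) (at s)"
    by (rule DERIV_chain2[OF DERIV_x]) (auto intro!: derivative_eq_intros)
  then show "((\<lambda>s. x (\<nu> * s)) has_real_derivative \<nu> * x' (\<nu> * s)) (at s)" by (simp add: mult_ac)
  have "((\<lambda>s. x (s / \<nu>)) has_real_derivative x' (s / \<nu>) * (1 / \<nu>)) (at s)"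
    by (rule DERIV_chain2[OF DERIV_x]) (use \<nu> in \<open>auto intro!: derivative_eq_intros\<close>)
  then show "((\<lambda>s. x (\<nu> * s)) has_real_derivative
      (2 + lam * cos (2 * pi * x s)) * x' s - x' (s / \<nu>) / \<nu>) (at s)"
    unfolding x_step
    by (auto intro!: derivative_eq_intros DERIV_x simp: algebra_simps)
qed

text \<open>
  The derivative of \<open>x\<close> solves a linear second-order recurrence along \<open>s / \<nu> ^ n\<close>, so
  two consecutive zeros would propagate backwards to \<open>x' 0\<close>.
\<close>

lemma lift_curve'_nonzero: "lift_curve' s \<noteq> 0"
proof
  assume "lift_curve' s = 0"
  then have start: "x' s = 0" "x' (s / \<nu>) = 0"
    using \<nu> by (auto simp: lift_curve'_def zero_prod_def)
  have "x' (s / \<nu> ^ n) = 0 \<and> x' (s / \<nu> ^ Suc n) = 0" for n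
  proof (induction n)
    case (Suc n)
    then show ?case using x'_step[of "s / \<nu> ^ Suc n"] \<nu> by (simp add: mult_ac)
  qed (simp add: start)
  moreover have "(\<lambda>n. x' (s / \<nu> ^ n)) \<longlonglongrightarrow> x' 0"
    by (rule continuous_on_tendsto_compose[OF cont_x' shrink_to_0]) auto
  ultimately show False using x'0 by (simp add: LIMSEQ_const_iff)
qed

lemma curve_parameterization_\<gamma>: "curve_parameterization \<gamma> (unstable_manifold f p)"
  unfolding curve_parameterization_def
  by (intro conjI exI[of _ lift_curve] exI[of _ lift_curve'] allI
      inj_\<gamma> range_\<gamma> \<gamma>_def lift_curve_derivative continuous_lift_curve' lift_curve'_nonzero)

lemma curve_parameterization_reversor_\<gamma>:
  "curve_parameterization (reversor \<circ> \<gamma>) (stable_manifold f p)"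
proof -
  let ?L = "\<lambda>v :: real \<times> real. (fst v - snd v, - snd v)"
  have bl: "bounded_linear ?L"
    by (intro bounded_linear_Pair bounded_linear_sub bounded_linear_minus bounded_linear_fst bounded_linear_snd)
  have "inj reversor" by (rule inj_on_inverseI[of _ reversor]) simp
  then have inj: "inj (reversor \<circ> \<gamma>)" using inj_\<gamma> by (intro inj_compose)
  have range: "range (reversor \<circ> \<gamma>) = stable_manifold f p"
    by (simp add: stable_manifold_eq_reversor image_comp flip: range_\<gamma>)
  have lift: "(reversor \<circ> \<gamma>) t = torus_of (?L (lift_curve t))" for t
    by (simp add: \<gamma>_def reversor.abs_eq case_prod_beta)
  have deriv: "((\<lambda>t. ?L (lift_curve t)) has_vector_derivative ?L (lift_curve' t)) (at t)" for t
    by (rule bounded_linear.has_vector_derivative[OF bl lift_curve_derivative])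
  have cont: "continuous_on UNIV (\<lambda>t. ?L (lift_curve' t))"
    by (intro continuous_intros continuous_lift_curve')
  have nz: "?L (lift_curve' t) \<noteq> 0" for t
    using lift_curve'_nonzero[of t] by (auto simp: prod_eq_iff)
  show ?thesis unfolding curve_parameterization_def
    by (intro conjI exI[of _ "\<lambda>t. ?L (lift_curve t)"] exI[of _ "\<lambda>t. ?L (lift_curve' t)"] allI
        inj range lift deriv cont nz)
qed

lemma unstable_branches_eq: "unstable_branches f p = {\<gamma> ` {..<0}, \<gamma> ` {0<..}}"
  unfolding unstable_branches_def
  by (rule curve_branches_eq[OF curve_parameterization_\<gamma> \<gamma>_0 continuous_standard_map f_\<gamma> \<nu>])

text \<open>
  For the stable manifold the expansion of the parameter is the action of the inverse map.
\<close>

lemma stable_branches_eq: "stable_branches f p = {(reversor \<circ> \<gamma>) ` {..<0}, (reversor \<circ> \<gamma>) ` {0<..}}"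
  unfolding stable_branches_def
proof (rule curve_branches_eq[OF curve_parameterization_reversor_\<gamma> _ _ _ \<nu>])
  show "(reversor \<circ> \<gamma>) 0 = p" by (simp add: \<gamma>_0 reversor.abs_eq)
  have "inv f z = reversor (f (reversor z))" for z
    using inv_standard_map_reversor[of lam "reversor z"] by simp
  then have "inv f = (\<lambda>z. reversor (f (reversor z)))" by (rule ext)
  then show "continuous_on UNIV (inv f)"
    using continuous_on_compose2[OF continuous_reversor
        continuous_on_compose2[OF continuous_standard_map continuous_reversor]] by simp
  show "inv f ((reversor \<circ> \<gamma>) s) = (reversor \<circ> \<gamma>) (\<nu> * s)" for s
    by (simp add: inv_standard_map_reversor f_\<gamma>)
qed

text \<open>
  The force \<open>kick\<close> is nonnegative on \<open>{0..1/2}\<close>.  As long as an orbit on the curve stays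
  there its increments do not decrease, so it cannot stay forever; by continuity the curve meets
  the line on which the position is \<open>1/2\<close>.
\<close>

lemma x_reaches_half: "\<exists>s>0. x s = 1/2"
proof (rule ccontr)
  assume never: "\<not> ?thesis"
  have below: "x s < 1/2" if "s > 0" for s
  proof (rule ccontr)
    assume "\<not> x s < 1/2"
    then have "\<exists>t\<ge>0. t \<le> s \<and> x t = 1/2"
      using that x_0 cont_x by (intro IVT') (auto intro: continuous_on_subset)
    then obtain t where "t \<ge> 0" "x t = 1/2" by blast
    then show False using never x_0 by (cases "t = 0") auto
  qed
  obtain \<epsilon> where \<epsilon>: "\<epsilon> > 0" "\<forall>s t. \<bar>s\<bar> \<le> \<epsilon> \<and> \<bar>t\<bar> \<le> \<epsilon> \<and> s < t \<longrightarrow> x s < x t"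
    using x_near_0[OF zero_less_one] by blast
  have \<epsilon>\<nu>: "0 < \<epsilon> / \<nu>" "\<epsilon> / \<nu> < \<epsilon>" using \<epsilon> \<nu> by (auto simp: divide_less_eq)
  define d where "d = x \<epsilon> - x (\<epsilon> / \<nu>)"
  have d: "d > 0" using \<epsilon>(2)[rule_format, of "\<epsilon> / \<nu>" \<epsilon>] \<epsilon>\<nu> by (simp add: d_def)
  have "x (\<epsilon> * \<nu> ^ n) \<ge> real n * d \<and> x (\<epsilon> * \<nu> ^ n) \<ge> x (\<epsilon> * \<nu> ^ n / \<nu>) + d" for n
  proof (induction n)
    case 0
    then show ?case using \<epsilon>(2)[rule_format, of 0 \<epsilon>] \<epsilon>(1) x_0 by (simp add: d_def)
  next
    case (Suc n)
    let ?s = "\<epsilon> * \<nu> ^ n"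
    have "0 \<le> real n * d" using d by simp
    then have "0 \<le> kick (x ?s)"
      using Suc.IH below[of ?s] \<epsilon>(1) \<nu> by (intro kick_nonneg) auto
    moreover have "x (\<epsilon> * \<nu> ^ Suc n) = 2 * x ?s - x (?s / \<nu>) + kick (x ?s)"
      using x_step[of ?s] by (simp add: kick_def mult_ac)
    moreover have "\<epsilon> * \<nu> ^ Suc n / \<nu> = ?s" using \<nu> by simp
    ultimately show ?case using Suc.IH by (simp add: algebra_simps)
  qed
  moreover obtain n where "1/2 < real n * d" using reals_Archimedean3[OF d] by blast
  ultimately show False using below[of "\<epsilon> * \<nu> ^ n"] \<epsilon>(1) \<nu> by (smt (verit) mult_pos_pos zero_less_power)
qed

text \<open>
  The recurrence has the time-reversing symmetry that also replaces positions \<open>t\<close> by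
  \<open>- t\<close>, hence by \<open>1 - t\<close> on the torus.  An orbit with position \<open>1/2\<close> at time
  \<open>0\<close> is symmetric, because \<open>kick\<close> vanishes at \<open>1/2\<close>: positions \<open>n\<close> steps before
  and after add up to \<open>1\<close>.
\<close>

lemma symmetric_homoclinic_point:
  assumes "x s = 1/2"
  shows "\<gamma> s = reversor (\<gamma> (- \<nu> * s))" and "\<gamma> (- s) = reversor (\<gamma> (\<nu> * s))"
proof -
  have "kick (x s) = 0" by (simp add: kick_def assms)
  then have next_x: "x (\<nu> * s) = 1 - x (s / \<nu>)" using x_step[of s] by (simp add: assms kick_def)
  have "\<nu> * s / \<nu> = s" using \<nu> by simp
  then show "\<gamma> s = reversor (\<gamma> (- \<nu> * s))" "\<gamma> (- s) = reversor (\<gamma> (\<nu> * s))"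
    by (simp_all add: \<gamma>_def lift_curve_def reversor.abs_eq torus_of_eq_iff torus_rel_def next_x assms odd)
qed

lemma homoclinic_pointI:
  assumes "\<gamma> s = reversor (\<gamma> t)" "s \<noteq> 0"
  shows "\<gamma> s \<in> homoclinic_points f p"
proof -
  have "\<gamma> s \<in> stable_manifold f p"
    unfolding stable_manifold_eq_reversor assms(1) using \<gamma>_in_unstable_manifold by blast
  moreover have "\<gamma> s \<noteq> p" using assms(2) inj_\<gamma> \<gamma>_0 by (metis injD)
  ultimately show ?thesis using \<gamma>_in_unstable_manifold by (simp add: homoclinic_points_def)
qed

lemma branches_have_homoclinic_points:
  assumes "B \<in> stable_branches f p \<union> unstable_branches f p"
  shows "has_homoclinic_points f p B"
proof -
  obtain s where s: "s > 0" "x s = 1/2" using x_reaches_half by blast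
  note sym = symmetric_homoclinic_point[OF s(2)]
  have hom: "\<gamma> s \<in> homoclinic_points f p" "\<gamma> (- s) \<in> homoclinic_points f p"
    using homoclinic_pointI[OF sym(1)] homoclinic_pointI[OF sym(2)] s by auto
  have "\<gamma> s \<in> \<gamma> ` {0<..}" "\<gamma> (- s) \<in> \<gamma> ` {..<0}"
    using s by (auto intro!: imageI)
  moreover have "\<gamma> s \<in> (reversor \<circ> \<gamma>) ` {..<0}" "\<gamma> (- s) \<in> (reversor \<circ> \<gamma>) ` {0<..}"
    using s \<nu> sym by (auto intro!: image_eqI[of _ _ "- \<nu> * s"] image_eqI[of _ _ "\<nu> * s"])
  ultimately show ?thesis
    using assms hom unfolding has_homoclinic_points_def stable_branches_eq unstable_branches_eq by blast
qed

lemma card_half_lines: "inj h \<Longrightarrow> card {h ` {..<0::real}, h ` {0<..}} = 2"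
proof -
  assume "inj h"
  have "(1::real) \<in> {0<..}" "(1::real) \<notin> {..<0}" by auto
  then have "{..<0::real} \<noteq> {0<..}" by blast
  then have "h ` {..<0} \<noteq> h ` {0<..}" using \<open>inj h\<close> by (simp add: inj_image_eq_iff)
  then show ?thesis by (rule card_2_iff[THEN iffD2, OF exI, OF exI, OF conjI, OF refl])
qed

lemma saddle_fixed_point_p: "saddle_fixed_point f p"
proof -
  let ?F = "\<lambda>v :: real \<times> real. (fst v + snd v + kick (fst v), snd v + kick (fst v))"
  let ?A = "\<lambda>v :: real \<times> real. (fst v + snd v + lam * fst v, snd v + lam * fst v)"
  have deriv: "(?F has_derivative ?A) (at (0, 0))"
    unfolding kick_def by (auto intro!: derivative_eq_intros)
  have lift: "f (torus_of w) = torus_of (?F w)" for w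
    by (cases w) (simp add: f_torus_of)
  have "lam = \<nu> + 1 / \<nu> - 2" using trace by simp
  then have eigen: "?A (1, 1 - \<nu>) = (1 / \<nu>) *\<^sub>R (1, 1 - \<nu>)"
      "?A (1, 1 - 1 / \<nu>) = \<nu> *\<^sub>R (1, 1 - 1 / \<nu>)"
    using \<nu> by (simp_all add: field_simps)
  have size: "\<bar>1 / \<nu>\<bar> < 1" "1 < \<bar>\<nu>\<bar>" using \<nu> by auto
  have nz: "(1::real, 1 - \<nu>) \<noteq> 0" "(1::real, 1 - 1 / \<nu>) \<noteq> 0" by (auto simp: zero_prod_def)
  have fixed: "f p = p" by (simp add: f_torus_of kick_def)
  show ?thesis unfolding saddle_fixed_point_def
    by (intro conjI allI fixed exI[of _ ?F] exI[of _ "(0, 0)"] exI[of _ ?A] exI[of _ "1 / \<nu>"]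
        exI[of _ \<nu>] exI[of _ "(1, 1 - \<nu>)"] exI[of _ "(1, 1 - 1 / \<nu>)"] refl lift deriv eigen size nz)
qed

end


theorem theorem5p1:
  fixes lam :: real
  assumes "lam \<noteq> 4" and "lam > 0"
  defines "f \<equiv> standard_map lam" and "p \<equiv> torus_of (0, 0)"
  shows "saddle_fixed_point f p \<and>
    card (stable_branches f p) = 2 \<and> card (unstable_branches f p) = 2 \<and>
    (\<forall>B \<in> stable_branches f p \<union> unstable_branches f p. has_homoclinic_points f p B)"
proof -
  obtain \<nu> x x' where "unstable_solution lam \<nu> x x'"
    using real_unstable_solution[OF assms(2)] assms(2) unfolding unstable_solution_def by metis
  then interpret unstable_solution lam \<nu> x x' .
  have "card (unstable_branches f p) = 2"
    unfolding f_def p_def unstable_branches_eq by (rule card_half_lines[OF inj_\<gamma>])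
  moreover have "card (stable_branches f p) = 2"
    unfolding f_def p_def stable_branches_eq
    by (rule card_half_lines) (use curve_parameterization_reversor_\<gamma> in \<open>simp add: curve_parameterization_def\<close>)
  ultimately show ?thesis
    using saddle_fixed_point_p branches_have_homoclinic_points unfolding f_def p_def by blast
qed

end
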